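(* Let $n\ge1$ and let $K$ be a connected pure $n$-simplicial complex. Then $K$ is a simplicial tree if and only if all of the following hold: (1) between any two distinct $(n-1)$-simplices of $K$ there exists a unique reduced $(n-1,n)$-path sequence; (2) if $n\ge 2$, then for every $0\le m\le n-2$ and any two distinct $m$-simplices $\sigma_i,\sigma_j$ of $K$ that are not both faces of a common joint $(n-1)$-simplex, there exists a unique reduced simplicial path between $\sigma_i$ and $\sigma_j$; (3) if $n\ge2$, then for every $0\le m\le n-2$, $K$ contains no $(m,n)$-simplicial cycle sequence.
   Context: A simplicial complex $K$ on a finite vertex set is a collection of non-empty vertex subsets containing all singletons and closed under taking non-empty subsets; a $k$-simplex has $k+1$ vertices, and $\tau$ is a face of $\sigma$ if $\tau\subseteq\sigma$. $K$ is a pure $n$-simplicial complex if $\dim K=n$ and every simplex is a face of some $n$-simplex of $K$. For a set $S$ of simplices, $\overline{S}$ is the set of all faces of members of $S$. Let $0\le m\le n-1$. An $(m,n)$-walk sequence between $m$-simplices $\sigma,\sigma'$ is an alternating sequence $\sigma=\sigma_1,\eta_1,\sigma_2,\dots,\sigma_r,\eta_r,\sigma_{r+1}=\sigma'$ of $m$-simplices $\sigma_k$ and $n$-simplices $\eta_k$ of $K$ with $\sigma_k\ne\sigma_{k+1}$ and both faces of $\eta_k$ ($1\le k\le r$). It is an $(m,n)$-path sequence if all its simplices are distinct. $K$ is connected if there is an $(n-1,n)$-path sequence between every pair of distinct $(n-1)$-simplices. An $(m,n)$-path sequence $\sigma_1,\eta_1,\dots,\sigma_r,\eta_r,\sigma_{r+1}$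 is reduced if (i) among $\eta_1,\dots,\eta_r$, $\sigma_1$ is a face only of $\eta_1$ and $\sigma_{r+1}$ is a face only of $\eta_r$; (ii) for each $2\le z\le r$ there is an $(n-1)$-simplex $\sigma'_z$ of $K$ which is a face of both $\eta_{z-1}$ and $\eta_z$ and has $\sigma_z$ as a face, with $\sigma'_x\ne\sigma'_y$ for $2\le x\neq y\le r$. The subcomplex $\overline{\{\eta_1,\dots,\eta_r\}}$ is the reduced simplicial path of this sequence; a reduced simplicial path between $\sigma_i,\sigma_j$ means the reduced simplicial path of some reduced $(m,n)$-path sequence between them. An $(m,n)$-circuit sequence is an $(m,n)$-walk sequence with $\sigma_{r+1}=\sigma_1$ and $\sigma_p\ne\sigma_q$, $\eta_p\ne\eta_q$ for $1\le p\ne q\le r$; it is an $(m,n)$-simplicial cycle sequence if moreover $r\ge 3$, $\sigma_1$ is not a face of $\eta_k$ for $2\le k\le r-1$, and condition (ii) above holds (for each $2\le z\le r$ an $(n-1)$-simplex $\sigma'_z$ face of $\eta_{z-1}$ and $\eta_z$ containing $\sigma_z$, pairwise distinct). $K$ is acyclic if it has no $(m,n)$-simplicial cycle sequence for any $0\le m\le n-1$; a simplicial tree is a connected acyclic pure $n$-simplicial complex. A simplex is joint if it is a face of at least two distinct $n$-simplices of $K$. *)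

theory Defs
  imports Main
begin

text \<open>
  A simplex is its set of vertices, and "\<open>\<tau>\<close> is a face of \<open>\<sigma>\<close>" is \<open>\<tau> \<subseteq> \<sigma>\<close>.
\<close>

definition simplicial_complex :: "'v set \<Rightarrow> 'v set set \<Rightarrow> bool" where
  "simplicial_complex V K \<longleftrightarrow>
     finite V \<and>
     (\<forall>\<sigma>\<in>K. \<sigma> \<noteq> {} \<and> \<sigma> \<subseteq> V) \<and>
     (\<forall>v\<in>V. {v} \<in> K) \<and>
     (\<forall>\<sigma>\<in>K. \<forall>\<tau>. \<tau> \<noteq> {} \<and> \<tau> \<subseteq> \<sigma> \<longrightarrow> \<tau> \<in> K)"

definition simplices :: "'v set set \<Rightarrow> nat \<Rightarrow> 'v set set" where
  "simplices K k = {\<sigma>\<in>K. card \<sigma> = k + 1}"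

text \<open>The value on the empty complex is unspecified.\<close>

definition complex_dim :: "'v set set \<Rightarrow> nat" where
  "complex_dim K = Max ((\<lambda>\<sigma>. card \<sigma> - 1) ` K)"

definition pure_complex :: "'v set \<Rightarrow> 'v set set \<Rightarrow> nat \<Rightarrow> bool" where
  "pure_complex V K n \<longleftrightarrow>
     simplicial_complex V K \<and> K \<noteq> {} \<and> complex_dim K = n \<and>
     (\<forall>\<sigma>\<in>K. \<exists>\<eta>\<in>simplices K n. \<sigma> \<subseteq> \<eta>)"

definition face_closure :: "'v set set \<Rightarrow> 'v set set" where
  "face_closure S = {\<tau>. \<tau> \<noteq> {} \<and> (\<exists>\<sigma>\<in>S. \<tau> \<subseteq> \<sigma>)}"

text \<open>
  An alternating sequence \<open>\<sigma>\<^sub>1, \<eta>\<^sub>1, \<sigma>\<^sub>2, \<dots>, \<sigma>\<^sub>r, \<eta>\<^sub>r, \<sigma>\<^sub>r\<^sub>+\<^sub>1\<close> is given by the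
  two lists \<open>ss = [\<sigma>\<^sub>1, \<dots>, \<sigma>\<^sub>r\<^sub>+\<^sub>1]\<close> and \<open>es = [\<eta>\<^sub>1, \<dots>, \<eta>\<^sub>r]\<close> with \<open>r = length es \<ge> 1\<close>.
  Positions are shifted by one: \<open>\<sigma>\<^sub>k = ss ! (k - 1)\<close> and \<open>\<eta>\<^sub>k = es ! (k - 1)\<close>.
\<close>

definition walk_seq ::
  "'v set set \<Rightarrow> nat \<Rightarrow> nat \<Rightarrow> 'v set list \<Rightarrow> 'v set list \<Rightarrow> bool" where
  "walk_seq K m n ss es \<longleftrightarrow>
     es \<noteq> [] \<and> length ss = length es + 1 \<and>
     set ss \<subseteq> simplices K m \<and> set es \<subseteq> simplices K n \<and>
     (\<forall>k<length es. ss ! k \<noteq> ss ! (k + 1) \<and> ss ! k \<subseteq> es ! k \<and> ss ! (k + 1) \<subseteq> es ! k)"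

definition path_seq ::
  "'v set set \<Rightarrow> nat \<Rightarrow> nat \<Rightarrow> 'v set list \<Rightarrow> 'v set list \<Rightarrow> bool" where
  "path_seq K m n ss es \<longleftrightarrow> walk_seq K m n ss es \<and> distinct (ss @ es)"

definition connected_complex :: "'v set set \<Rightarrow> nat \<Rightarrow> bool" where
  "connected_complex K n \<longleftrightarrow>
     (\<forall>\<sigma>\<in>simplices K (n - 1). \<forall>\<sigma>'\<in>simplices K (n - 1). \<sigma> \<noteq> \<sigma>' \<longrightarrow>
        (\<exists>ss es. path_seq K (n - 1) n ss es \<and> hd ss = \<sigma> \<and> last ss = \<sigma>'))"

text \<open>
  The condition shared by reduced path sequences and simplicial cycle sequences. The
  index \<open>z\<close> here is the usual one minus 1, so \<open>2 \<le> z \<le> r\<close> becomes \<open>1 \<le> z < r\<close>.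
\<close>

definition linked ::
  "'v set set \<Rightarrow> nat \<Rightarrow> 'v set list \<Rightarrow> 'v set list \<Rightarrow> bool" where
  "linked K n ss es \<longleftrightarrow>
     (\<exists>\<sigma>'. (\<forall>z\<in>{1..<length es}.
              \<sigma>' z \<in> simplices K (n - 1) \<and>
              \<sigma>' z \<subseteq> es ! (z - 1) \<and> \<sigma>' z \<subseteq> es ! z \<and> ss ! z \<subseteq> \<sigma>' z) \<and>
           inj_on \<sigma>' {1..<length es})"

definition reduced_path_seq ::
  "'v set set \<Rightarrow> nat \<Rightarrow> nat \<Rightarrow> 'v set list \<Rightarrow> 'v set list \<Rightarrow> bool" where
  "reduced_path_seq K m n ss es \<longleftrightarrow>
     path_seq K m n ss es \<and>
     (\<forall>k<length es. hd ss \<subseteq> es ! k \<longrightarrow> k = 0) \<and>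
     (\<forall>k<length es. last ss \<subseteq> es ! k \<longrightarrow> k = length es - 1) \<and>
     linked K n ss es"

definition reduced_path_between ::
  "'v set set \<Rightarrow> nat \<Rightarrow> nat \<Rightarrow> 'v set \<Rightarrow> 'v set \<Rightarrow> 'v set list \<times> 'v set list \<Rightarrow> bool" where
  "reduced_path_between K m n \<sigma> \<sigma>' p \<longleftrightarrow>
     reduced_path_seq K m n (fst p) (snd p) \<and> hd (fst p) = \<sigma> \<and> last (fst p) = \<sigma>'"

definition reduced_simplicial_path ::
  "'v set set \<Rightarrow> nat \<Rightarrow> nat \<Rightarrow> 'v set \<Rightarrow> 'v set \<Rightarrow> 'v set set \<Rightarrow> bool" where
  "reduced_simplicial_path K m n \<sigma> \<sigma>' P \<longleftrightarrow>
     (\<exists>p. reduced_path_between K m n \<sigma> \<sigma>' p \<and> P = face_closure (set (snd p)))"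

definition circuit_seq ::
  "'v set set \<Rightarrow> nat \<Rightarrow> nat \<Rightarrow> 'v set list \<Rightarrow> 'v set list \<Rightarrow> bool" where
  "circuit_seq K m n ss es \<longleftrightarrow>
     walk_seq K m n ss es \<and> last ss = hd ss \<and> distinct (butlast ss) \<and> distinct es"

definition simplicial_cycle_seq ::
  "'v set set \<Rightarrow> nat \<Rightarrow> nat \<Rightarrow> 'v set list \<Rightarrow> 'v set list \<Rightarrow> bool" where
  "simplicial_cycle_seq K m n ss es \<longleftrightarrow>
     circuit_seq K m n ss es \<and> length es \<ge> 3 \<and>
     (\<forall>k\<in>{1..<length es - 1}. \<not> hd ss \<subseteq> es ! k) \<and>
     linked K n ss es"

definition acyclic_complex :: "'v set set \<Rightarrow> nat \<Rightarrow> bool" where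
  "acyclic_complex K n \<longleftrightarrow> (\<forall>m<n. \<nexists>ss es. simplicial_cycle_seq K m n ss es)"

definition simplicial_tree :: "'v set \<Rightarrow> 'v set set \<Rightarrow> nat \<Rightarrow> bool" where
  "simplicial_tree V K n \<longleftrightarrow>
     pure_complex V K n \<and> connected_complex K n \<and> acyclic_complex K n"

definition joint :: "'v set set \<Rightarrow> nat \<Rightarrow> 'v set \<Rightarrow> bool" where
  "joint K n \<sigma> \<longleftrightarrow>
     (\<exists>\<eta>\<in>simplices K n. \<exists>\<eta>'\<in>simplices K n. \<eta> \<noteq> \<eta>' \<and> \<sigma> \<subseteq> \<eta> \<and> \<sigma> \<subseteq> \<eta>')"

end

theory Submission
  imports Defs
begin

text \<open>
  Consider the bipartite incidence graph of \<open>(n - 1)\<close>-simplices (ridges) and \<open>n\<close>-simplices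
  (facets). Having no simplicial cycle of dimension \<open>n - 1\<close> means that this graph is a tree, which
  is equivalent to uniqueness of reduced paths between ridges. Having no simplicial cycle of
  dimension 0 makes the stars of vertices, hence of all simplices, convex in this tree. A reduced
  simplicial path between two lower-dimensional simplices is then a shortest path between two
  subtrees, which is unique unless both simplices lie in a common joint ridge.
\<close>

section \<open>Simple paths in a graph\<close>

text \<open>The obstacle is that two dimensions are mixed: path and cycle sequences ask for pairwise
  distinct \<open>m\<close>-simplices, while the incidence graph supplies only ridges. Distinct
  \<open>m\<close>-faces of the ridges along a path exist because of convexity: a vertex that has
  dropped out of the ridges never returns. But convexity is itself proved by building a cycle
  sequence from such faces, so its proof is an induction on path length in which all shorter paths
  are already convex. The intermediate \<open>m\<close>-faces can in general be chosen in several
  ways and only the facets are determined; hence (2) compares subcomplexes where (1) compares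
  sequences. The exception in (2) is forced: if both simplices lie in a joint ridge, every facet
  containing that ridge is by itself a reduced path. Conversely, (3) excludes cycle sequences for
  \<open>m\<close> below \<open>n - 1\<close>, and (1) excludes those for \<open>m = n - 1\<close>,
  because the two ways round such a cycle give two reduced paths.\<close>

definition simple_path :: "('a \<Rightarrow> 'a \<Rightarrow> bool) \<Rightarrow> 'a list \<Rightarrow> bool" where
  "simple_path E p \<longleftrightarrow> p \<noteq> [] \<and> distinct p \<and> successively E p"

lemma simple_path_take:
  assumes "simple_path E p" "0 < k"
  shows "simple_path E (take k p)"
proof -
  have "successively E (take k p @ drop k p)" using assms by (simp add: simple_path_def)
  then have "successively E (take k p)" by (simp only: successively_append_iff)
  with assms show ?thesis by (simp add: simple_path_def)
qed

lemma simple_path_drop: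
  assumes "simple_path E p" "k < length p"
  shows "simple_path E (drop k p)"
proof -
  have "successively E (take k p @ drop k p)" using assms by (simp add: simple_path_def)
  then have "successively E (drop k p)" by (simp only: successively_append_iff)
  with assms show ?thesis by (simp add: simple_path_def)
qed

lemma simple_path_slice:
  assumes "simple_path E p" "i \<le> k" "k < length p"
  obtains q where "simple_path E q" "hd q = p ! i" "last q = p ! k" "length q = Suc k - i"
    "\<And>j. i \<le> j \<Longrightarrow> j \<le> k \<Longrightarrow> p ! j \<in> set q"
proof (rule that)
  let ?q = "drop i (take (Suc k) p)"
  have "simple_path E (take (Suc k) p)" using assms(1) by (rule simple_path_take) simp
  then show "simple_path E ?q" by (rule simple_path_drop) (use assms in simp)
  show len: "length ?q = Suc k - i" using assms by simp
  have "?q \<noteq> []" using assms by simp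
  then show "hd ?q = p ! i" "last ?q = p ! k" using assms len
    by (auto simp: hd_conv_nth last_conv_nth)
  fix j assume "i \<le> j" "j \<le> k"
  then have "?q ! (j - i) = p ! j" "j - i < length ?q" using assms by auto
  then show "p ! j \<in> set ?q" by (metis nth_mem)
qed

lemma successively_imp_rtranclp:
  "successively E p \<Longrightarrow> p \<noteq> [] \<Longrightarrow> E\<^sup>*\<^sup>* (hd p) (last p)"
proof (induction p)
  case (Cons x p)
  then show ?case
    by (cases "p = []") (auto simp: successively_Cons intro: converse_rtranclp_into_rtranclp)
qed simp

lemma simple_path_nth:
  "simple_path E p \<Longrightarrow> Suc i < length p \<Longrightarrow> E (p ! i) (p ! Suc i)"
  by (simp add: simple_path_def successively_conv_nth)

lemma last_append_tl: "q \<noteq> [] \<Longrightarrow> last p = hd q \<Longrightarrow> last (p @ tl q) = last q"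
  by (cases q) auto

lemma simple_path_append_tl:
  assumes p: "simple_path E p" and q: "simple_path E q" and "last p = hd q"
    and inter: "set p \<inter> set q \<subseteq> {hd q}"
  shows "simple_path E (p @ tl q)"
proof -
  obtain y q' where qq: "q = y # q'" using q by (cases q) (auto simp: simple_path_def)
  then have "set p \<inter> set q' = {}" using inter q by (auto simp: simple_path_def)
  then show ?thesis
    using p q assms(3) unfolding simple_path_def qq
    by (auto simp: successively_append_iff successively_Cons)
qed

text \<open>The path is pruned while it grows: when the next vertex already lies on it, it is cut
  back to that vertex instead of being extended.\<close>

lemma rtranclp_imp_simple_path:
  assumes "E\<^sup>*\<^sup>* x y"
  shows "\<exists>p. simple_path E p \<and> hd p = x \<and> last p = y"
  using assms
proof (induction rule: rtranclp_induct)
  case base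
  then show ?case by (intro exI[of _ "[x]"]) (simp add: simple_path_def)
next
  case (step y z)
  then obtain p where p: "simple_path E p" "hd p = x" "last p = y" by blast
  show ?case
  proof (cases "z \<in> set p")
    case True
    then obtain i where i: "i < length p" "p ! i = z" by (auto simp: in_set_conv_nth)
    have "simple_path E (take (Suc i) p)" using p(1) by (rule simple_path_take) simp
    moreover have "last (take (Suc i) p) = z" using i by (simp add: take_Suc_conv_app_nth)
    moreover have "hd (take (Suc i) p) = x" using p by (cases p) auto
    ultimately show ?thesis by blast
  next
    case False
    then have "simple_path E (p @ [z])"
      using p step.hyps(2) by (auto simp: simple_path_def successively_append_iff)
    then show ?thesis using p by (intro exI[of _ "p @ [z]"]) (auto simp: simple_path_def)
  qed
qed

text \<open>For a symmetric \<open>E\<close>, two adjacent vertices would always close up; the bound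
  3 excludes such an edge traversed back and forth, and also a loop.\<close>

definition graph_cycle :: "('a \<Rightarrow> 'a \<Rightarrow> bool) \<Rightarrow> 'a list \<Rightarrow> bool" where
  "graph_cycle E p \<longleftrightarrow> simple_path E p \<and> 3 \<le> length p \<and> E (last p) (hd p)"

text \<open>Two paths that part after a common vertex \<open>a\<close> must meet again, at the
  latest in their common end. The pieces up to the first meeting point \<open>c\<close> enclose a
  cycle.\<close>

lemma simple_path_unique:
  assumes sym: "\<And>x y. E x y \<Longrightarrow> E y x" and nc: "\<And>p. \<not> graph_cycle E p"
  shows "simple_path E p \<Longrightarrow> simple_path E q \<Longrightarrow> hd p = hd q \<Longrightarrow> last p = last q \<Longrightarrow> p = q"
proof (induction p arbitrary: q)
  case Nil
  then show ?case by (simp add: simple_path_def)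
next
  case (Cons a p')
  obtain q' where q: "q = a # q'" using Cons.prems by (cases q) (auto simp: simple_path_def)
  have da: "a \<notin> set p'" "a \<notin> set q'" "distinct p'" "distinct q'"
    using Cons.prems q by (auto simp: simple_path_def)
  show ?case
  proof (cases "p' = [] \<or> q' = []")
    case True
    then show ?thesis using Cons.prems q da
      by (metis last.simps last_in_set)
  next
    case False
    then have ne: "p' \<noteq> []" "q' \<noteq> []" by auto
    have sp: "simple_path E p'" "simple_path E q'" and Ea: "E a (hd p')" "E a (hd q')"
      using Cons.prems q ne by (auto simp: simple_path_def successively_Cons)
    have lst: "last p' = last q'" using Cons.prems q ne by simp
    show ?thesis
    proof (cases "hd p' = hd q'")
      case True
      then show ?thesis using Cons.IH[OF sp(1) sp(2)] lst q by simp
    next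
      case False
      have "\<exists>x\<in>set p'. x \<in> set q'" using lst ne by (metis last_in_set)
      then obtain p1 c p2 where p': "p' = p1 @ c # p2" and c: "c \<in> set q'"
        and p1: "\<forall>x\<in>set p1. x \<notin> set q'"
        using split_list_first_prop[of p' "\<lambda>x. x \<in> set q'"] by blast
      obtain q1 q2 where q': "q' = q1 @ c # q2" using c by (metis split_list)
      have s1: "successively E (a # p1 @ [c])"
        using sp(1) Ea(1) unfolding p'
        by (auto simp: simple_path_def successively_append_iff successively_Cons hd_append)
      have "successively E (a # q1 @ [c])"
        using sp(2) Ea(2) unfolding q'
        by (auto simp: simple_path_def successively_append_iff successively_Cons hd_append)
      then have "successively (\<lambda>x y. E y x) (rev (a # q1 @ [c]))"
        by (simp only: successively_rev)
      then have s2: "successively E (c # rev q1 @ [a])"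
        using sym by (auto elim: successively_mono)
      \<comment> \<open>Out along the first path to \<open>c\<close>, back along the second. The
        second vertices of the two paths differ, so \<open>p1\<close> and \<open>q1\<close> are not
        both empty and the length is at least 3.\<close>
      let ?c = "a # p1 @ c # rev q1"
      have "successively E (?c @ [a])"
        using s1 s2 by (auto simp: successively_append_iff successively_Cons hd_append)
      from iffD1[OF successively_append_iff this]
      have "successively E ?c" "E (last ?c) (hd ?c)" by simp_all
      moreover have "distinct ?c" using da p1 unfolding p' q' by auto
      moreover have "3 \<le> length ?c" using False unfolding p' q' by (cases p1; cases q1) auto
      ultimately have "graph_cycle E ?c" by (simp add: graph_cycle_def simple_path_def)
      with nc show ?thesis by blast
    qed
  qed
qed

section \<open>Alternating lists\<close>

text \<open>\<open>splice\<close> exchanges its arguments at each step. The pair of length bounds is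
  preserved by this exchange, whereas the equation \<open>length xs = Suc (length ys)\<close> of the
  later lemmas is not.\<close>

lemma nth_splice:
  "length ys \<le> length xs \<Longrightarrow> length xs \<le> Suc (length ys) \<Longrightarrow> k < length xs + length ys \<Longrightarrow>
   splice xs ys ! k = (if even k then xs ! (k div 2) else ys ! (k div 2))"
proof (induction xs ys arbitrary: k rule: splice.induct)
  case (1 ys)
  then show ?case by simp
next
  case (2 x xs ys)
  show ?case
  proof (cases k)
    case 0
    then show ?thesis by simp
  next
    case (Suc j)
    have "splice ys xs ! j = (if even j then ys ! (j div 2) else xs ! (j div 2))"
      using 2 Suc by simp
    then show ?thesis using Suc by (auto elim!: oddE evenE)
  qed
qed

lemma nth_splice_even:
  "length xs = Suc (length ys) \<Longrightarrow> k < length xs \<Longrightarrow> splice xs ys ! (2 * k) = xs ! k"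
  by (subst nth_splice) auto

lemma nth_splice_odd:
  "length xs = Suc (length ys) \<Longrightarrow> k < length ys \<Longrightarrow> splice xs ys ! Suc (2 * k) = ys ! k"
  by (subst nth_splice) auto

lemma hd_last_splice:
  assumes "length xs = Suc (length ys)"
  shows "hd (splice xs ys) = hd xs" "last (splice xs ys) = last xs"
proof -
  have ne: "xs \<noteq> []" "splice xs ys \<noteq> []" using assms by (auto simp flip: length_0_conv)
  then show "hd (splice xs ys) = hd xs" by (cases xs) auto
  have "last (splice xs ys) = splice xs ys ! (2 * length ys)"
    using ne assms by (simp add: last_conv_nth mult_2)
  then show "last (splice xs ys) = last xs"
    using ne assms by (simp add: nth_splice_even last_conv_nth)
qed

lemma splice_eq_imp_eq:
  assumes "length xs = Suc (length ys)" "length xs' = Suc (length ys')"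
    and eq: "splice xs ys = splice xs' ys'"
  shows "xs = xs' \<and> ys = ys'"
proof -
  have "length xs + length ys = length xs' + length ys'"
    using eq by (metis length_splice)
  then have len: "length ys = length ys'" "length xs = length xs'" using assms by auto
  then show ?thesis
    using assms by (metis nth_equalityI nth_splice_even nth_splice_odd)
qed

lemma successively_splice:
  "length xs = Suc (length ys) \<Longrightarrow>
   successively E (splice xs ys) \<longleftrightarrow> (\<forall>i<length ys. E (xs ! i) (ys ! i) \<and> E (ys ! i) (xs ! Suc i))"
proof (induction ys arbitrary: xs)
  case Nil
  then show ?case by (cases xs) auto
next
  case (Cons y ys)
  obtain x x' xs' where xs: "xs = x # x' # xs'" using Cons.prems
    by (metis Suc_length_conv length_Cons)
  have "successively E (splice (x' # xs') ys) \<longleftrightarrow>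
    (\<forall>i<length ys. E ((x' # xs') ! i) (ys ! i) \<and> E (ys ! i) ((x' # xs') ! Suc i))"
    using Cons xs by (intro Cons.IH) simp
  then show ?case unfolding xs
    by (auto simp: All_less_Suc2)
qed

lemma distinct_splice:
  "distinct xs \<Longrightarrow> distinct ys \<Longrightarrow> set xs \<inter> set ys = {} \<Longrightarrow> distinct (splice xs ys)"
  by (rule distinct_disjoint_shuffles[OF _ _ _ splice_in_shuffles])

text \<open>\<open>P\<close> varies in the induction because removing the head exchanges the roles
  of \<open>P\<close> and its negation, in step with the exchange of arguments in
  \<open>splice\<close>.\<close>

lemma alternating_split:
  "successively (\<lambda>x y. P x \<noteq> P y) p \<Longrightarrow> p = [] \<or> P (hd p) \<Longrightarrow>
   \<exists>xs ys. p = splice xs ys \<and> (\<forall>x\<in>set xs. P x) \<and> (\<forall>y\<in>set ys. \<not> P y) \<and>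
     length ys \<le> length xs \<and> length xs \<le> Suc (length ys)"
proof (induction p arbitrary: P)
  case Nil
  then show ?case by (intro exI[of _ "[]"]) auto
next
  case (Cons x p)
  have "successively (\<lambda>x y. (\<not> P x) \<noteq> (\<not> P y)) p"
    using Cons.prems by (auto simp: successively_Cons elim: successively_mono)
  moreover have "p = [] \<or> \<not> P (hd p)" using Cons.prems by (auto simp: successively_Cons)
  ultimately obtain xs ys where "p = splice xs ys" "\<forall>x\<in>set xs. \<not> P x" "\<forall>y\<in>set ys. \<not> \<not> P y"
     "length ys \<le> length xs" "length xs \<le> Suc (length ys)"
    using Cons.IH[of "\<lambda>x. \<not> P x"] by blast
  then show ?case using Cons.prems by (intro exI[of _ "x # ys"] exI[of _ xs]) auto
qed

lemma alternating_split_odd: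
  assumes "successively (\<lambda>x y. P x \<noteq> P y) p" "p \<noteq> []" "P (hd p)" "P (last p)"
  obtains xs ys where "p = splice xs ys" "\<forall>x\<in>set xs. P x" "\<forall>y\<in>set ys. \<not> P y"
    "length xs = Suc (length ys)"
proof -
  obtain xs ys where p: "p = splice xs ys" "\<forall>x\<in>set xs. P x" "\<forall>y\<in>set ys. \<not> P y"
    and len: "length ys \<le> length xs" "length xs \<le> Suc (length ys)"
    using alternating_split[OF assms(1)] assms(3) by blast
  \<comment> \<open>With equal lengths the last entry would come from \<open>ys\<close>, where
    \<open>P\<close> fails.\<close>
  have "length xs \<noteq> length ys"
  proof
    assume eq: "length xs = length ys"
    have pos: "0 < length ys" using assms(2) p(1) eq by (cases ys) auto
    then have "last p = p ! Suc (2 * (length ys - 1))"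
      using assms(2) eq p(1) by (cases "length ys") (simp_all add: last_conv_nth mult_2)
    also have "\<dots> = ys ! (length ys - 1)"
      unfolding p(1) using pos eq by (cases "length ys") (simp_all add: nth_splice)
    finally show False using assms(4) p(3) pos by (metis diff_less nth_mem zero_less_one)
  qed
  with len p that show ?thesis by auto
qed

section \<open>The incidence graph of facets and ridges\<close>

lemma card_simplices: "x \<in> simplices K k \<Longrightarrow> card x = Suc k"
  by (simp add: simplices_def)

lemma finite_simplices: "x \<in> simplices K k \<Longrightarrow> finite x"
  using card_simplices card.infinite by fastforce

lemma ridge_not_facet: "0 < n \<Longrightarrow> x \<in> simplices K n \<Longrightarrow> x \<notin> simplices K (n - 1)"
  by (auto dest!: card_simplices)

text \<open>Vertices of the graph are plain sets, and their cardinality tells the two sides of the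
  bipartition apart. For \<open>n = 0\<close> truncated subtraction makes both sides coincide, which
  is why \<open>0 < n\<close> accompanies the lemmas below.\<close>

definition incident :: "'v set set \<Rightarrow> nat \<Rightarrow> 'v set \<Rightarrow> 'v set \<Rightarrow> bool" where
  "incident K n x y \<longleftrightarrow>
     x \<in> simplices K (n - 1) \<and> y \<in> simplices K n \<and> x \<subseteq> y \<or>
     y \<in> simplices K (n - 1) \<and> x \<in> simplices K n \<and> y \<subseteq> x"

lemma incident_sym: "incident K n x y \<Longrightarrow> incident K n y x"
  by (auto simp: incident_def)

lemma incident_facet: "0 < n \<Longrightarrow> x \<in> simplices K n \<Longrightarrow>
    incident K n x y \<longleftrightarrow> y \<in> simplices K (n - 1) \<and> y \<subseteq> x"
  using ridge_not_facet[of n _ K] by (auto simp: incident_def)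

lemma incident_alternating:
  assumes "0 < n" "successively (incident K n) p"
  shows "successively (\<lambda>x y. (x \<in> simplices K n) \<noteq> (y \<in> simplices K n)) p"
    "successively (\<lambda>x y. (x \<notin> simplices K n) \<noteq> (y \<notin> simplices K n)) p"
  using assms(1) by (auto intro!: successively_mono[OF assms(2)]
      simp: incident_def dest!: card_simplices)

lemma incident_mem:
  assumes "successively (incident K n) p" "2 \<le> length p" "x \<in> set p"
  shows "x \<in> simplices K (n - 1) \<or> x \<in> simplices K n"
proof -
  obtain i where i: "i < length p" "p ! i = x" using assms(3) by (auto simp: in_set_conv_nth)
  show ?thesis
  proof (cases "Suc i < length p")
    case True
    then have "incident K n (p ! i) (p ! Suc i)" using assms(1) by (simp add: successively_conv_nth)
    then show ?thesis using i by (auto simp: incident_def)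
  next
    case False
    then obtain j where "i = Suc j" using assms(2) i(1) by (cases i) auto
    then have "incident K n (p ! j) (p ! i)"
      using assms(1) i(1) by (simp add: successively_conv_nth)
    then show ?thesis using i by (auto simp: incident_def)
  qed
qed

text \<open>Galleries in the sense of chamber complexes: facets \<open>es\<close> as chambers, with
  the ridges \<open>ts\<close> as the walls crossed between consecutive ones. They are the simple
  paths of the incidence graph that start and end in a facet, whereas path sequences for
  \<open>m = n - 1\<close> start and end in a ridge.\<close>

definition gallery :: "'v set set \<Rightarrow> nat \<Rightarrow> 'v set list \<Rightarrow> 'v set list \<Rightarrow> bool" where
  "gallery K n ts es \<longleftrightarrow> length es = Suc (length ts) \<and>
     set es \<subseteq> simplices K n \<and> set ts \<subseteq> simplices K (n - 1) \<and> distinct es \<and> distinct ts \<and>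
     (\<forall>i<length ts. ts ! i \<subseteq> es ! i \<and> ts ! i \<subseteq> es ! Suc i)"

lemma simplices_disjoint: "m < k \<Longrightarrow> simplices K m \<inter> simplices K k = {}"
  by (auto dest!: card_simplices)

lemma gallery_imp_simple_path:
  assumes "0 < n" "gallery K n ts es"
  shows "simple_path (incident K n) (splice es ts)"
proof -
  have g: "length es = Suc (length ts)" "set es \<subseteq> simplices K n" "set ts \<subseteq> simplices K (n - 1)"
    "distinct es" "distinct ts" "\<forall>i<length ts. ts ! i \<subseteq> es ! i \<and> ts ! i \<subseteq> es ! Suc i"
    using assms(2) by (auto simp: gallery_def)
  have "set es \<inter> set ts = {}" using simplices_disjoint[of "n - 1" n K] assms(1) g by auto
  then have "distinct (splice es ts)" using g by (simp add: distinct_splice)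
  moreover have "successively (incident K n) (splice es ts)"
    unfolding successively_splice[OF g(1)]
  proof (intro allI impI)
    fix i assume i: "i < length ts"
    then have "es ! i \<in> simplices K n" "es ! Suc i \<in> simplices K n" "ts ! i \<in> simplices K (n - 1)"
      using g by (auto simp: subset_iff)
    then show "incident K n (es ! i) (ts ! i) \<and> incident K n (ts ! i) (es ! Suc i)"
      using g(6) i by (auto simp: incident_def)
  qed
  moreover have "splice es ts \<noteq> []" using g(1) by (auto simp flip: length_0_conv)
  ultimately show ?thesis by (simp add: simple_path_def)
qed

lemma simple_path_imp_gallery:
  assumes "0 < n" "simple_path (incident K n) p" "hd p \<in> simplices K n" "last p \<in> simplices K n"
  obtains es ts where "p = splice es ts" "gallery K n ts es"
proof -
  have s: "successively (incident K n) p" "p \<noteq> []" "distinct p"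
    using assms by (auto simp: simple_path_def)
  obtain es ts where p: "p = splice es ts" and es: "\<forall>x\<in>set es. x \<in> simplices K n"
    and ts: "\<forall>y\<in>set ts. y \<notin> simplices K n" and len: "length es = Suc (length ts)"
    by (rule alternating_split_odd[OF incident_alternating(1)[OF assms(1) s(1)] s(2)])
       (use assms in auto)
  have inc: "\<forall>i<length ts. incident K n (es ! i) (ts ! i) \<and> incident K n (ts ! i) (es ! Suc i)"
    using s(1) unfolding p successively_splice[OF len] .
  have f: "ts ! i \<in> simplices K (n - 1) \<and> ts ! i \<subseteq> es ! i \<and> ts ! i \<subseteq> es ! Suc i"
    if i: "i < length ts" for i
  proof -
    have "ts ! i \<notin> simplices K n" using ts i by simp
    then show ?thesis using inc i by (auto simp: incident_def)
  qed
  have "distinct es"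
  proof (unfold distinct_conv_nth, intro allI impI)
    fix i j assume ij: "i < length es" "j < length es" "i \<noteq> j"
    then have "p ! (2 * i) \<noteq> p ! (2 * j)" using s(3) len by (simp add: nth_eq_iff_index_eq p)
    then show "es ! i \<noteq> es ! j" using ij len by (simp add: p nth_splice_even)
  qed
  moreover have "distinct ts"
  proof (unfold distinct_conv_nth, intro allI impI)
    fix i j assume ij: "i < length ts" "j < length ts" "i \<noteq> j"
    then have "p ! Suc (2 * i) \<noteq> p ! Suc (2 * j)" using s(3) len by (simp add: nth_eq_iff_index_eq p)
    then show "ts ! i \<noteq> ts ! j" using ij len by (simp add: p nth_splice_odd)
  qed
  ultimately have "gallery K n ts es"
    using f es len by (auto simp: gallery_def in_set_conv_nth)
  with p that show ?thesis by blast
qed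

lemma path_seq_imp_simple_path:
  assumes "0 < n" "path_seq K (n - 1) n ss es"
  shows "simple_path (incident K n) (splice ss es)"
proof -
  have g: "length ss = Suc (length es)" "set ss \<subseteq> simplices K (n - 1)" "set es \<subseteq> simplices K n"
    "distinct (ss @ es)" "\<forall>i<length es. ss ! i \<subseteq> es ! i \<and> ss ! Suc i \<subseteq> es ! i"
    using assms(2) by (auto simp: path_seq_def walk_seq_def)
  have "distinct (splice ss es)" using g(4) by (simp add: distinct_splice)
  moreover have "successively (incident K n) (splice ss es)"
    unfolding successively_splice[OF g(1)]
  proof (intro allI impI)
    fix i assume i: "i < length es"
    then have "ss ! i \<in> simplices K (n - 1)" "ss ! Suc i \<in> simplices K (n - 1)" "es ! i \<in> simplices K n"
      using g by (auto simp: subset_iff)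
    then show "incident K n (ss ! i) (es ! i) \<and> incident K n (es ! i) (ss ! Suc i)"
      using g(5) i by (auto simp: incident_def)
  qed
  moreover have "splice ss es \<noteq> []" using g(1) by (auto simp flip: length_0_conv)
  ultimately show ?thesis by (simp add: simple_path_def)
qed

section \<open>Cycles of the incidence graph and cycle sequences for
  \<open>m = n - 1\<close>\<close>

lemma closed_walk_imp_circuit:
  assumes n: "0 < n" and s: "successively (incident K n) c" and len: "4 \<le> length c"
    and hl: "hd c \<in> simplices K (n - 1)" "last c = hd c" and d: "distinct (butlast c)"
  shows "\<exists>ss es. circuit_seq K (n - 1) n ss es \<and> 2 \<le> length es"
proof -
  have hd: "hd c \<notin> simplices K n" using hl(1) n by (auto dest!: card_simplices)
  obtain ss es where c: "c = splice ss es" and ss: "\<forall>x\<in>set ss. x \<notin> simplices K n"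
    and es: "\<forall>y\<in>set es. \<not> y \<notin> simplices K n" and l: "length ss = Suc (length es)"
    by (rule alternating_split_odd[OF incident_alternating(2)[OF n s]])
       (use hd hl len in auto)
  have inc: "\<forall>i<length es. incident K n (ss ! i) (es ! i) \<and> incident K n (es ! i) (ss ! Suc i)"
    using s unfolding c successively_splice[OF l] .
  have ssm: "set ss \<subseteq> simplices K (n - 1)"
  proof
    fix x assume x: "x \<in> set ss"
    then have "x \<in> set c" using set_shuffles[OF splice_in_shuffles, of ss es] by (simp add: c)
    moreover have "x \<notin> simplices K n" using x ss by blast
    ultimately show "x \<in> simplices K (n - 1)" using incident_mem[OF s] len by auto
  qed
  have lc: "length c = Suc (2 * length es)" using l by (simp add: c)
  \<comment> \<open>The bound 4 is the shortest graph cycle, of length 3, with its first vertex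
    repeated at the end. Since the length is odd, it is in fact at least 5.\<close>
  have l2: "2 \<le> length es" using lc len by simp
  have inj: "c ! i \<noteq> c ! j" if "i < 2 * length es" "j < 2 * length es" "i \<noteq> j" for i j
    using d that lc by (auto simp: distinct_conv_nth nth_butlast)
  have "distinct es"
  proof (unfold distinct_conv_nth, intro allI impI)
    fix i j assume ij: "i < length es" "j < length es" "i \<noteq> j"
    then have "c ! Suc (2 * i) \<noteq> c ! Suc (2 * j)" by (intro inj) auto
    then show "es ! i \<noteq> es ! j" using ij l by (simp add: c nth_splice_odd)
  qed
  moreover have ds: "distinct (butlast ss)"
  proof (unfold distinct_conv_nth, intro allI impI)
    fix i j assume "i < length (butlast ss)" "j < length (butlast ss)" "i \<noteq> j"
    then have ij: "i < length es" "j < length es" "i \<noteq> j" using l by auto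
    then have "c ! (2 * i) \<noteq> c ! (2 * j)" by (intro inj) auto
    then show "butlast ss ! i \<noteq> butlast ss ! j" using ij l by (simp add: c nth_splice_even nth_butlast)
  qed
  moreover have last: "last ss = hd ss" using hl hd_last_splice[OF l] by (simp add: c)
  moreover have "walk_seq K (n - 1) n ss es"
    unfolding walk_seq_def
  proof (intro conjI allI impI)
    show "es \<noteq> []" "length ss = length es + 1" "set ss \<subseteq> simplices K (n - 1)" "set es \<subseteq> simplices K n"
      using l2 l ssm es by auto
    fix i assume i: "i < length es"
    have m: "es ! i \<in> simplices K n" using es i by simp
    have "incident K n (es ! i) (ss ! i)" "incident K n (es ! i) (ss ! Suc i)"
      using inc i incident_sym by blast+
    then show "ss ! i \<subseteq> es ! i" "ss ! (i + 1) \<subseteq> es ! i"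
      using incident_facet[OF n m] by simp_all
    \<comment> \<open>Distinctness covers \<open>butlast c\<close> only, so the last pair wraps
      around to position 0; there \<open>2 \<le> length es\<close> ensures that \<open>i\<close> is
      not 0.\<close>
    have "c ! (2 * i) \<noteq> c ! (2 * Suc i)" 
    proof (cases "Suc i < length es")
      case True
      then show ?thesis by (intro inj) auto
    next
      case False
      then have "Suc i = length es" using i by simp
      moreover have ne: "c \<noteq> []" using lc by auto
      ultimately have "c ! (2 * Suc i) = hd c" using hl(2) lc by (simp add: last_conv_nth)
      also have "\<dots> = c ! 0" using ne by (rule hd_conv_nth)
      also have "\<dots> \<noteq> c ! (2 * i)" using l2 i False by (intro inj) auto
      finally show ?thesis by simp
    qed
    moreover have "c ! (2 * i) = ss ! i" "c ! (2 * Suc i) = ss ! Suc i"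
      unfolding c using i l by (auto intro!: nth_splice_even simp del: mult_Suc_right)
    ultimately show "ss ! i \<noteq> ss ! (i + 1)" by simp
  qed
  ultimately show ?thesis using l2 unfolding circuit_seq_def by blast
qed

text \<open>Two distinct \<open>n\<close>-sets already cover a set of \<open>n + 1\<close> elements.
  Hence distinct facets share at most one ridge, which rules out circuits with only two
  facets.\<close>

lemma facet_eq_Un_ridges:
  assumes "0 < n" "x \<in> simplices K (n - 1)" "y \<in> simplices K (n - 1)" "x \<noteq> y"
    "e \<in> simplices K n" "x \<subseteq> e" "y \<subseteq> e"
  shows "e = x \<union> y"
proof -
  have f: "finite x" "finite y" "finite e" using assms finite_simplices by blast+
  have c: "card x = n" "card y = n" "card e = Suc n" using assms by (auto dest!: card_simplices)
  have "\<not> y \<subseteq> x" using card_subset_eq[OF f(1)] c assms(4) by metis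
  then have "x \<subset> x \<union> y" by blast
  then have "n < card (x \<union> y)" using f c psubset_card_mono[of "x \<union> y" x] by auto
  then show ?thesis using card_seteq[of e "x \<union> y"] f c assms by auto
qed

text \<open>For \<open>m = n - 1\<close> every inner simplex is its own connecting ridge. Asking for
  distinctness of the inner entries only makes this apply both to paths and to closed sequences,
  whose first entry recurs at the end.\<close>

lemma linked_ridges:
  assumes "walk_seq K (n - 1) n ss es" "distinct (tl (butlast ss))"
  shows "linked K n ss es"
  unfolding linked_def
proof (intro exI[of _ "\<lambda>z. ss ! z"] conjI ballI)
  have w: "length ss = Suc (length es)" "set ss \<subseteq> simplices K (n - 1)"
    "\<forall>k<length es. ss ! k \<subseteq> es ! k \<and> ss ! Suc k \<subseteq> es ! k"
    using assms(1) by (auto simp: walk_seq_def)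
  show "inj_on (\<lambda>z. ss ! z) {1..<length es}"
  proof (rule inj_onI)
    fix x y assume xy: "x \<in> {1..<length es}" "y \<in> {1..<length es}" "ss ! x = ss ! y"
    have e: "ss ! z = tl (butlast ss) ! (z - 1)" if "z \<in> {1..<length es}" for z
    proof -
      obtain j where "z = Suc j" "Suc j < length es" using \<open>z \<in> _\<close> by (cases z) auto
      then show ?thesis using w(1) by (simp add: nth_tl nth_butlast)
    qed
    have "x - 1 = y - 1"
      using xy e[OF xy(1)] e[OF xy(2)] assms(2) w(1)
      by (subst nth_eq_iff_index_eq[OF assms(2), symmetric]) auto
    then show "x = y" using xy by auto
  qed
  fix z assume z: "z \<in> {1..<length es}"
  show "ss ! z \<in> simplices K (n - 1)" using z w by (auto simp: subset_iff)
  show "ss ! z \<subseteq> es ! z" using z w by auto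
  show "ss ! z \<subseteq> es ! (z - 1)" using z w(3)[rule_format, of "z - 1"]
    by (cases z) auto
qed simp

text \<open>A circuit of minimal length among those with at least two facets is a cycle sequence:
  two facets alone would coincide, and an inner facet containing the first ridge would permit a
  shortcut.\<close>

lemma circuit_imp_simplicial_cycle:
  assumes n: "0 < n" and ex: "\<exists>ss es. circuit_seq K (n - 1) n ss es \<and> 2 \<le> length es"
  shows "\<exists>ss es. simplicial_cycle_seq K (n - 1) n ss es"
proof -
  let ?Q = "\<lambda>r. \<exists>ss es. circuit_seq K (n - 1) n ss es \<and> 2 \<le> length es \<and> length es = r"
  from ex have "\<exists>r. ?Q r" by blast
  then obtain r where "?Q r" and least: "\<And>r'. r' < r \<Longrightarrow> \<not> ?Q r'"
    using exists_least_iff[of ?Q] by blast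
  then obtain ss es where c: "circuit_seq K (n - 1) n ss es" and l2: "2 \<le> length es"
    and r: "length es = r" by blast
  have w: "walk_seq K (n - 1) n ss es" and lh: "last ss = hd ss" and ds: "distinct (butlast ss)"
    and de: "distinct es" using c by (auto simp: circuit_seq_def)
  have ww: "length ss = Suc (length es)" "set ss \<subseteq> simplices K (n - 1)" "set es \<subseteq> simplices K n"
    "\<forall>k<length es. ss ! k \<noteq> ss ! Suc k \<and> ss ! k \<subseteq> es ! k \<and> ss ! Suc k \<subseteq> es ! k"
    using w by (auto simp: walk_seq_def)
  have ne: "ss \<noteq> []" using ww(1) by auto
  then have h0: "hd ss = ss ! 0" by (rule hd_conv_nth)
  have ssd: "ss ! i \<noteq> ss ! j" if "i < length es" "j < length es" "i \<noteq> j" for i j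
    using ds that ww(1) by (auto simp: distinct_conv_nth nth_butlast)
  have "length es \<noteq> 2"
  proof
    assume e2: "length es = 2"
    have ls: "ss ! 2 = ss ! 0" using lh h0 ww(1) e2 ne by (simp add: last_conv_nth)
    have "es ! i = ss ! 0 \<union> ss ! 1" if "i < 2" for i
    proof (rule facet_eq_Un_ridges[OF n])
      show "ss ! 0 \<in> simplices K (n - 1)" "ss ! 1 \<in> simplices K (n - 1)" "es ! i \<in> simplices K n"
        using ww e2 that by (auto simp: subset_iff)
      show "ss ! 0 \<noteq> ss ! 1" using ssd e2 by auto
      have "i = 0 \<or> i = 1" using that by auto
      then show "ss ! 0 \<subseteq> es ! i" "ss ! 1 \<subseteq> es ! i"
        using ww(4)[rule_format, of 0] ww(4)[rule_format, of 1] e2 ls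
        by (auto simp: numeral_2_eq_2)
    qed
    then have "es ! 0 = es ! 1" by auto
    then show False using de e2 by (simp add: nth_eq_iff_index_eq)
  qed
  moreover have "\<not> hd ss \<subseteq> es ! k" if k: "k \<in> {1..<length es - 1}" for k
  proof
    assume sub: "hd ss \<subseteq> es ! k"
    \<comment> \<open>The shortcut: stop at the facet \<open>es ! k\<close> and return from it
      directly to the first ridge. The range of \<open>k\<close> leaves at least two facets and
      drops at least one.\<close>
    let ?ss = "take (Suc k) ss @ [hd ss]" and ?es = "take (Suc k) es"
    have lt: "length (take (Suc k) ss) = Suc k" "length ?es = Suc k" using k ww(1) by auto
    have "walk_seq K (n - 1) n ?ss ?es"
      unfolding walk_seq_def
    proof (intro conjI allI impI)
      show "?es \<noteq> []" "length ?ss = length ?es + 1" using k ww(1) by auto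
      show "set ?ss \<subseteq> simplices K (n - 1)" "set ?es \<subseteq> simplices K n"
        using ww(2,3) hd_in_set[OF ne] by (auto dest: in_set_takeD)
      fix i assume "i < length ?es"
      then have i: "i \<le> k" "i < length es" using lt k by auto
      have a: "?ss ! i = ss ! i" "?es ! i = es ! i" using i lt ww(1) by (auto simp: nth_append)
      show "?ss ! i \<subseteq> ?es ! i" using a ww(4) i by auto
      have b: "?ss ! (i + 1) = (if i < k then ss ! Suc i else ss ! 0)"
        using i lt h0 by (auto simp: nth_append)
      show "?ss ! (i + 1) \<subseteq> ?es ! i" using a b ww(4) i sub h0 by (auto split: if_splits)
      show "?ss ! i \<noteq> ?ss ! (i + 1)" using a b ww(4) i ssd[of i 0] k l2
        by (cases "i < k") force+
    qed
    moreover have "last ?ss = hd ?ss" using ww(1) by (cases ss) auto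
    moreover have "distinct (butlast ?ss)"
    proof -
      have "take (Suc k) ss = take (Suc k) (butlast ss)" using k ww(1)
        by (intro nth_equalityI) (auto simp: nth_butlast)
      then show ?thesis using ds by (simp add: butlast_append)
    qed
    ultimately have "circuit_seq K (n - 1) n ?ss ?es" using de by (simp add: circuit_seq_def)
    moreover have "2 \<le> length ?es" "length ?es < r" using k lt r by auto
    ultimately show False using least by blast
  qed
  moreover have "linked K n ss es"
    using linked_ridges[OF w] ds by (simp add: distinct_tl)
  ultimately have "simplicial_cycle_seq K (n - 1) n ss es"
    using c l2 unfolding simplicial_cycle_seq_def by auto
  then show ?thesis by blast
qed

lemma acyclic_complex_no_graph_cycle:
  assumes n: "0 < n" and "acyclic_complex K n"
  shows "\<not> graph_cycle (incident K n) p"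
proof
  assume "graph_cycle (incident K n) p"
  then have s: "successively (incident K n) p" and d: "distinct p" and len: "3 \<le> length p"
    and cl: "incident K n (last p) (hd p)"
    by (auto simp: graph_cycle_def simple_path_def)
  obtain x y q where p: "p = x # y # q" "q \<noteq> []"
    using len by (auto simp: numeral_3_eq_3 Suc_le_length_iff)
  have "\<exists>ss es. circuit_seq K (n - 1) n ss es \<and> 2 \<le> length es"
  proof (cases "x \<in> simplices K (n - 1)")
    case True
    have "successively (incident K n) (p @ [x])"
      using s cl p by (auto simp: successively_append_iff successively_Cons hd_append)
    then show ?thesis
      by (rule closed_walk_imp_circuit[OF n]) (use d len p True in auto)
  next
    case False
    \<comment> \<open>The cycle starts in a facet, so it is rotated by one place to start in a
      ridge.\<close>
    then have "y \<in> simplices K (n - 1)" using s p by (auto simp: incident_def)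
    moreover have "successively (incident K n) (y # q @ [x, y])"
      using s cl p by (auto simp: successively_append_iff successively_Cons hd_append)
    ultimately show ?thesis
      using d len p by (intro closed_walk_imp_circuit[OF n]) (auto simp: butlast_append)
  qed
  then have "\<exists>ss es. simplicial_cycle_seq K (n - 1) n ss es"
    by (rule circuit_imp_simplicial_cycle[OF n])
  then show False using assms by (auto simp: acyclic_complex_def)
qed

lemma incident_path_unique:
  assumes "0 < n" "acyclic_complex K n" "simple_path (incident K n) p" "simple_path (incident K n) q"
    "hd p = hd q" "last p = last q"
  shows "p = q"
  using simple_path_unique[of "incident K n"] incident_sym
    acyclic_complex_no_graph_cycle[OF assms(1,2)] assms(3-6) by blast

section \<open>Convexity of stars\<close>

lemma obtain_subset_with_elem:
  assumes "finite t" "d \<in> t" "m < card t"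
  obtains s where "s \<subseteq> t" "card s = Suc m" "d \<in> s"
proof -
  have "m \<le> card (t - {d})" using assms by simp
  then obtain s where s: "s \<subseteq> t - {d}" "card s = m" "finite s"
    by (meson obtain_subset_with_card_n)
  show ?thesis
    by (rule that[of "insert d s"]) (use s assms in \<open>auto simp: card_insert_if\<close>)
qed

text \<open>
  A vertex of a set that is missing from the next set is missing from all later ones, so
  the sets can be told apart by subsets containing such vertices.
\<close>

lemma distinct_subset_representatives:
  fixes ts :: "'v set list"
  assumes "\<And>t. t \<in> set ts \<Longrightarrow> card t = k" "m < k" "distinct ts"
    and "\<And>i j l. i < j \<Longrightarrow> j < l \<Longrightarrow> l < length ts \<Longrightarrow> ts ! i \<inter> ts ! l \<subseteq> ts ! j"
  shows "\<exists>ss. length ss = length ts \<and> distinct ss \<and>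
    (\<forall>i<length ts. ss ! i \<subseteq> ts ! i \<and> card (ss ! i) = Suc m)"
  using assms
proof (induction ts)
  case Nil
  then show ?case by simp
next
  case (Cons t ts)
  have "\<exists>ss. length ss = length ts \<and> distinct ss \<and>
    (\<forall>i<length ts. ss ! i \<subseteq> ts ! i \<and> card (ss ! i) = Suc m)"
  proof (rule Cons.IH)
    show "ts ! i \<inter> ts ! l \<subseteq> ts ! j" if "i < j" "j < l" "l < length ts" for i j l
      using Cons.prems(4)[of "Suc i" "Suc j" "Suc l"] that by simp
  qed (use Cons.prems in auto)
  then obtain ss where ss: "length ss = length ts" "distinct ss"
    "\<forall>i<length ts. ss ! i \<subseteq> ts ! i \<and> card (ss ! i) = Suc m" by blast
  have ct: "card t = k" using Cons.prems by simp
  have fin: "finite t" using ct Cons.prems(2) card.infinite by fastforce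
  have "\<exists>d\<in>t. \<forall>u\<in>set ts. d \<notin> u"
  proof (cases ts)
    case Nil
    then show ?thesis using ct Cons.prems(2) by (cases "t = {}") auto
  next
    case us: (Cons u us)
    have "card u = k" "u \<noteq> t" using Cons.prems(1)[of u] Cons.prems(3) us by auto
    moreover have "finite u" using \<open>card u = k\<close> Cons.prems(2) card.infinite by fastforce
    ultimately have "\<not> t \<subseteq> u" using ct card_subset_eq[of u t] by auto
    then obtain d where d: "d \<in> t" "d \<notin> u" by blast
    have "d \<notin> w" if w: "w \<in> set ts" for w
    proof
      assume dw: "d \<in> w"
      obtain l where l: "l < length ts" "ts ! l = w" using w by (auto simp: in_set_conv_nth)
      show False
      proof (cases l)
        case 0
        then show ?thesis using l d dw us by simp
      next
        case (Suc l')
        then show ?thesis using Cons.prems(4)[of 0 1 "Suc l"] l d dw us by auto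
      qed
    qed
    then show ?thesis using d by blast
  qed
  then obtain d where d: "d \<in> t" "\<forall>u\<in>set ts. d \<notin> u" by blast
  obtain s where s: "s \<subseteq> t" "card s = Suc m" "d \<in> s"
    using obtain_subset_with_elem[OF fin d(1)] ct Cons.prems(2) by metis
  have "s \<notin> set ss"
  proof
    assume "s \<in> set ss"
    then obtain i where "i < length ts" "ss ! i = s" using ss(1) by (auto simp: in_set_conv_nth)
    then show False using ss(3) s(3) d(2) by (metis nth_mem subsetD)
  qed
  then show ?case using ss s
    by (intro exI[of _ "s # ss"]) (auto simp: nth_Cons split: nat.splits)
qed

lemma face_in_simplices:
  assumes "simplicial_complex V K" "t \<in> K" "s \<subseteq> t" "card s = Suc m"
  shows "s \<in> simplices K m"
proof -
  have "s \<noteq> {}" using assms(4) by auto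
  moreover have "\<forall>\<sigma>\<in>K. \<forall>\<tau>. \<tau> \<noteq> {} \<and> \<tau> \<subseteq> \<sigma> \<longrightarrow> \<tau> \<in> K"
    using assms(1) unfolding simplicial_complex_def by (elim conjE)
  ultimately have "s \<in> K" using assms(2,3) by blast
  then show ?thesis using assms(4) by (simp add: simplices_def)
qed

text \<open>The faces \<open>us\<close> chosen in the ridges become the inner simplices and the
  ridges themselves do the linking. This serves cycle sequences, with \<open>x = y\<close>, as well
  as paths; the final disjunction covers a gallery of one facet, where \<open>x\<close> and
  \<open>y\<close> are consecutive.\<close>

lemma gallery_walk_seq:
  assumes g: "gallery K n ts es" and len: "length us = length ts"
    and us: "\<And>i. i < length ts \<Longrightarrow> us ! i \<in> simplices K m \<and> us ! i \<subseteq> ts ! i"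
    and d: "distinct us" and ends: "x \<in> simplices K m" "x \<subseteq> hd es" "y \<in> simplices K m" "y \<subseteq> last es"
    and ne: "x \<notin> set us" "y \<notin> set us" "ts \<noteq> [] \<or> x \<noteq> y"
  shows "walk_seq K m n (x # us @ [y]) es" "linked K n (x # us @ [y]) es"
proof -
  have gg: "length es = Suc (length ts)" "set es \<subseteq> simplices K n" "set ts \<subseteq> simplices K (n - 1)"
    "distinct ts" "\<forall>i<length ts. ts ! i \<subseteq> es ! i \<and> ts ! i \<subseteq> es ! Suc i"
    using g by (auto simp: gallery_def)
  have esne: "es \<noteq> []" using gg(1) by auto
  have x0: "x \<subseteq> es ! 0" using ends(2) esne by (simp add: hd_conv_nth)
  have yl: "y \<subseteq> es ! length ts" using ends(4) esne gg(1) by (simp add: last_conv_nth)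
  have nthS: "(x # us @ [y]) ! Suc i = (if i < length ts then us ! i else y)"
    if "i \<le> length ts" for i
    using that len by (auto simp: nth_append)
  show "walk_seq K m n (x # us @ [y]) es"
    unfolding walk_seq_def
  proof (intro conjI allI impI)
    show "es \<noteq> []" "length (x # us @ [y]) = length es + 1" "set es \<subseteq> simplices K n"
      using esne gg len by auto
    show "set (x # us @ [y]) \<subseteq> simplices K m"
      using us len ends by (auto simp: in_set_conv_nth)
    fix k assume k: "k < length es"
    have S: "(x # us @ [y]) ! (k + 1) = (if k < length ts then us ! k else y)"
      using nthS[of k] k gg(1) by simp
    have usk: "us ! i \<subseteq> es ! i \<and> us ! i \<subseteq> es ! Suc i" if "i < length ts" for i
      using us gg(5) that by blast
    show "(x # us @ [y]) ! (k + 1) \<subseteq> es ! k"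
      unfolding S using usk yl k gg(1) by (auto simp: less_Suc_eq)
    show "(x # us @ [y]) ! k \<subseteq> es ! k"
    proof (cases k)
      case 0
      then show ?thesis using x0 by simp
    next
      case (Suc j)
      then show ?thesis using nthS[of j] usk[of j] k gg(1) by simp
    qed
    have mem: "us ! i \<in> set us" if "i < length ts" for i using that len by simp
    show "(x # us @ [y]) ! k \<noteq> (x # us @ [y]) ! (k + 1)"
    proof (cases k)
      case 0
      then show ?thesis unfolding S using ne mem by auto
    next
      case (Suc j)
      then have "(x # us @ [y]) ! k = us ! j" "j < length ts" using nthS[of j] k gg(1) by auto
      then show ?thesis unfolding S using ne(2) mem[of j] d len Suc
        by (auto simp: nth_eq_iff_index_eq)
    qed
  qed
  show "linked K n (x # us @ [y]) es"
    unfolding linked_def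
  \<comment> \<open>The entry at position \<open>z\<close> belongs to the ridge between facets
    \<open>z - 1\<close> and \<open>z\<close>, and that ridge has index \<open>z - 1\<close> in
    \<open>ts\<close>.\<close>
  proof (intro exI[of _ "\<lambda>z. ts ! (z - 1)"] conjI ballI)
    show "inj_on (\<lambda>z. ts ! (z - 1)) {1..<length es}"
      using gg(1,4) by (auto simp: inj_on_def nth_eq_iff_index_eq)
    fix z assume z: "z \<in> {1..<length es}"
    then obtain j where j: "z = Suc j" "j < length ts" using gg(1) by (cases z) auto
    show "ts ! (z - 1) \<in> simplices K (n - 1)" using gg(3) j by (auto simp: subset_iff)
    show "ts ! (z - 1) \<subseteq> es ! (z - 1)" "ts ! (z - 1) \<subseteq> es ! z" using gg(5) j by auto
    show "(x # us @ [y]) ! z \<subseteq> ts ! (z - 1)" using nthS[of j] us j by auto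
  qed
qed

text \<open>
  On a shortest path violating this, the ridges have distinct representing vertices, and
  together with the vertex in both ends these form a cycle sequence of dimension 0.
\<close>

lemma incident_path_convex:
  assumes n: "0 < n" and K: "simplicial_complex V K" and ac: "acyclic_complex K n"
  shows "simple_path (incident K n) p \<Longrightarrow> v \<in> hd p \<Longrightarrow> v \<in> last p \<Longrightarrow> x \<in> set p \<Longrightarrow> v \<in> x"
proof (induction "length p" arbitrary: p v x rule: less_induct)
  case less
  note p = less.prems(1)
  have pne: "p \<noteq> []" using p by (simp add: simple_path_def)
  have v0: "v \<in> p ! 0" and vl: "v \<in> p ! (length p - 1)"
    using less.prems pne by (auto simp: hd_conv_nth last_conv_nth)
  \<comment> \<open>The induction hypothesis for proper subpaths; the bound on \<open>k - i\<close>
    says that the piece from \<open>i\<close> to \<open>k\<close> is shorter than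
    \<open>p\<close>.\<close>
  have IH: "d \<in> p ! j" if ijk: "i \<le> j" "j \<le> k" "k < length p" "k - i < length p - 1"
    and d: "d \<in> p ! i" "d \<in> p ! k" for i j k d
  proof -
    from p obtain q where q: "simple_path (incident K n) q" "hd q = p ! i" "last q = p ! k"
      "length q = Suc k - i" "p ! j \<in> set q"
      by (rule simple_path_slice[of _ _ i k]) (use ijk in auto)
    show ?thesis by (rule less.hyps[OF _ q(1)]) (use q ijk d in auto)
  qed
  \<comment> \<open>An inner occurrence of \<open>v\<close> cuts \<open>p\<close> into two shorter
    paths with \<open>v\<close> at both ends. Otherwise \<open>v\<close> occurs at the two ends
    only, and that situation leads to the forbidden cycle.\<close>
  show ?case
  proof (cases "\<exists>i. 0 < i \<and> i < length p - 1 \<and> v \<in> p ! i")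
    case True
    then obtain i where i: "0 < i" "i < length p - 1" "v \<in> p ! i" by blast
    obtain j where j: "j < length p" "p ! j = x" using less.prems by (auto simp: in_set_conv_nth)
    show ?thesis
    proof (cases "j \<le> i")
      case True
      then show ?thesis using IH[of 0 j i v] v0 i j by auto
    next
      case False
      then show ?thesis using IH[of i j "length p - 1" v] vl i j by auto
    qed
  next
    case False
    then have mid: "\<And>i. 0 < i \<Longrightarrow> i < length p - 1 \<Longrightarrow> v \<notin> p ! i" by blast
    show ?thesis
    proof (cases "length p \<le> 2")
      case True
      obtain j where j: "j < length p" "p ! j = x" using less.prems by (auto simp: in_set_conv_nth)
      then have "j = 0 \<or> j = length p - 1" using True by linarith
      then show ?thesis using j v0 vl by auto
    next
      case False
      then have l3: "3 \<le> length p" by simp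
      \<comment> \<open>A ridge at an end would be contained in its neighbour and pass
        \<open>v\<close> on to it, but no inner entry contains \<open>v\<close>.\<close>
      have hdE: "hd p \<in> simplices K n"
      proof (rule ccontr)
        assume "hd p \<notin> simplices K n"
        moreover have "incident K n (p ! 0) (p ! Suc 0)" using simple_path_nth[OF p, of 0] l3 by simp
        ultimately have "p ! 0 \<subseteq> p ! 1" using pne by (auto simp: incident_def hd_conv_nth)
        moreover have "v \<notin> p ! 1" using l3 by (intro mid) auto
        ultimately show False using v0 by blast
      qed
      have lastE: "last p \<in> simplices K n"
      proof (rule ccontr)
        assume "last p \<notin> simplices K n"
        moreover obtain k where k: "length p = Suc (Suc k)" "0 < k"
          using l3 by (intro that[of "length p - 2"]) auto
        moreover have "incident K n (p ! k) (p ! Suc k)" using simple_path_nth[OF p, of k] k by simp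
        ultimately have "p ! Suc k \<subseteq> p ! k" using pne by (auto simp: incident_def last_conv_nth)
        moreover have "v \<notin> p ! k" using k by (intro mid) auto
        ultimately show False using vl k by auto
      qed
      obtain es ts where pp: "p = splice es ts" and g: "gallery K n ts es"
        using simple_path_imp_gallery[OF n p hdE lastE] by blast
      have gg: "length es = Suc (length ts)" "set es \<subseteq> simplices K n" "set ts \<subseteq> simplices K (n - 1)"
        "distinct ts" "distinct es" "\<forall>i<length ts. ts ! i \<subseteq> es ! i \<and> ts ! i \<subseteq> es ! Suc i"
        using g by (auto simp: gallery_def)
      have lp: "length p = Suc (2 * length ts)" using gg(1) by (simp add: pp)
      have esn: "p ! (2 * i) = es ! i" if "i \<le> length ts" for i
        using that gg(1) by (simp add: pp nth_splice_even)
      have tsn: "p ! Suc (2 * i) = ts ! i" if "i < length ts" for i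
        using that gg(1) by (simp add: pp nth_splice_odd)
      have vts: "v \<notin> ts ! i" if "i < length ts" for i
        using mid[of "Suc (2 * i)"] tsn that lp by auto
      have ves: "v \<notin> es ! i" if "0 < i" "i < length ts" for i
        using mid[of "2 * i"] esn that lp by auto
      have ve0: "v \<in> es ! 0" using v0 esn[of 0] by simp
      have vel: "v \<in> es ! length ts" using vl esn[of "length ts"] lp by simp
      have esm: "es ! i \<in> simplices K n" if "i \<le> length ts" for i
        using gg(1,2) that by (auto simp: subset_iff)
      have tsm: "ts ! i \<in> simplices K (n - 1)" if "i < length ts" for i
        using gg(3) that by (auto simp: subset_iff)
      \<comment> \<open>If the two end facets shared a single ridge, each would be that ridge
        together with \<open>v\<close>, so they would be equal. Two or more ridges give the at least
        three facets that a cycle sequence requires.\<close>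
      have ts1: "length ts \<noteq> 1"
      proof
        assume l1: "length ts = 1"
        have "insert v (ts ! 0) = es ! i" if "i \<le> 1" for i
        proof (rule card_subset_eq)
          show "finite (es ! i)" using esm finite_simplices that l1 by metis
          have "i = 0 \<or> i = 1" using that by auto
          then show "insert v (ts ! 0) \<subseteq> es ! i" using ve0 vel l1 gg(6) by auto
          have "card (insert v (ts ! 0)) = Suc (card (ts ! 0))"
            using vts[of 0] finite_simplices[OF tsm[of 0]] l1 by simp
          then show "card (insert v (ts ! 0)) = card (es ! i)"
            using card_simplices[OF tsm[of 0]] card_simplices[OF esm[of i]] that l1 n by simp
        qed
        from this[of 0] this[of 1] have "es ! 0 = es ! 1" by simp
        then show False using gg(1,5) l1 by (simp add: nth_eq_iff_index_eq)
      qed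
      then have ts2: "2 \<le> length ts" using lp l3 by auto
      \<comment> \<open>Pieces from ridge to ridge omit both ends of \<open>p\<close>, so they are
        already convex and vertices representing the ridges can be chosen distinct.\<close>
      have "\<exists>ss. length ss = length ts \<and> distinct ss \<and>
        (\<forall>i<length ts. ss ! i \<subseteq> ts ! i \<and> card (ss ! i) = Suc 0)"
      proof (rule distinct_subset_representatives[OF _ n gg(4)])
        show "card t = n" if "t \<in> set ts" for t
          using that gg(3) n card_simplices[of t K "n - 1"] by auto
        fix i j l assume ijl: "i < j" "j < l" "l < length ts"
        show "ts ! i \<inter> ts ! l \<subseteq> ts ! j"
        proof
          fix d assume "d \<in> ts ! i \<inter> ts ! l"
          then have "d \<in> p ! Suc (2 * i)" "d \<in> p ! Suc (2 * l)" using tsn ijl by auto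
          then have "d \<in> p ! Suc (2 * j)"
            using ijl lp by (intro IH[of "Suc (2 * i)" "Suc (2 * j)" "Suc (2 * l)"]) auto
          then show "d \<in> ts ! j" using tsn ijl by auto
        qed
      qed
      then obtain us where us: "length us = length ts" "distinct us"
        "\<forall>i<length ts. us ! i \<subseteq> ts ! i \<and> card (us ! i) = Suc 0" by blast
      have vK: "{v} \<in> simplices K 0"
        using face_in_simplices[OF K, of "es ! 0" "{v}" 0] esm[of 0] ve0 by (auto simp: simplices_def)
      have vus: "{v} \<notin> set us" using vts us by (auto simp: in_set_conv_nth)
      have esne: "es \<noteq> []" using gg(1) by auto
      have usK: "us ! i \<in> simplices K 0 \<and> us ! i \<subseteq> ts ! i" if "i < length ts" for i
        using face_in_simplices[OF K, of "ts ! i" "us ! i" 0] us(3) tsm[OF that] that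
        by (auto simp: simplices_def)
      have ends: "{v} \<subseteq> hd es" "{v} \<subseteq> last es"
        using ve0 vel esne gg(1) by (auto simp: hd_conv_nth last_conv_nth)
      have "ts \<noteq> [] \<or> {v} \<noteq> {v}" using ts2 by auto
      note w = gallery_walk_seq[OF g us(1) usK us(2) vK ends(1) vK ends(2) vus vus this]
      have "simplicial_cycle_seq K 0 n ({v} # us @ [{v}]) es"
        unfolding simplicial_cycle_seq_def circuit_seq_def
        using w gg(1,5) us(2) vus ts2 ves by (auto simp: butlast_append)
      then show ?thesis using ac n by (auto simp: acyclic_complex_def)
    qed
  qed
qed

lemma incident_path_convex_nth:
  assumes "0 < n" "simplicial_complex V K" "acyclic_complex K n"
    and p: "simple_path (incident K n) p" and ijk: "i \<le> j" "j \<le> k" "k < length p"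
  shows "p ! i \<inter> p ! k \<subseteq> p ! j"
proof
  fix d assume d: "d \<in> p ! i \<inter> p ! k"
  from p obtain q where q: "simple_path (incident K n) q" "hd q = p ! i" "last q = p ! k"
    "p ! j \<in> set q"
    by (rule simple_path_slice[of _ _ i k]) (use ijk in auto)
  show "d \<in> p ! j"
    by (rule incident_path_convex[OF assms(1-3) q(1) _ _ q(4)]) (use q d in auto)
qed

lemma incident_path_convex_subset:
  assumes "0 < n" "simplicial_complex V K" "acyclic_complex K n"
    and "simple_path (incident K n) p" "s \<subseteq> hd p" "s \<subseteq> last p" "x \<in> set p"
  shows "s \<subseteq> x"
  using incident_path_convex[OF assms(1-4)] assms(5-7) by blast

text \<open>Connectedness speaks of ridges, so each of the two facets is first joined to one of its
  own ridges. These may coincide, a case that connectedness does not address.\<close>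

lemma incident_path_exists:
  assumes n: "0 < n" and K: "simplicial_complex V K" and con: "connected_complex K n"
    and xy: "x \<in> simplices K n" "y \<in> simplices K n"
  shows "\<exists>p. simple_path (incident K n) p \<and> hd p = x \<and> last p = y"
proof (rule rtranclp_imp_simple_path)
  have ridge: "\<exists>s. s \<in> simplices K (n - 1) \<and> s \<subseteq> z" if z: "z \<in> simplices K n" for z
  proof -
    obtain s where s: "s \<subseteq> z" "card s = n"
      using obtain_subset_with_card_n[of n z] card_simplices[OF z] by auto
    then have "s \<in> simplices K (n - 1)"
      using z n by (intro face_in_simplices[OF K, of z]) (auto simp: simplices_def)
    with s show ?thesis by blast
  qed
  obtain s where s: "s \<in> simplices K (n - 1)" "s \<subseteq> x" using ridge[OF xy(1)] by blast
  obtain t where t: "t \<in> simplices K (n - 1)" "t \<subseteq> y" using ridge[OF xy(2)] by blast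
  have "(incident K n)\<^sup>*\<^sup>* s t"
  proof (cases "s = t")
    case False
    then obtain ss es where p: "path_seq K (n - 1) n ss es" "hd ss = s" "last ss = t"
      using con s t unfolding connected_complex_def by blast
    have len: "length ss = Suc (length es)" using p by (simp add: path_seq_def walk_seq_def)
    have "simple_path (incident K n) (splice ss es)" by (rule path_seq_imp_simple_path[OF n p(1)])
    then have "(incident K n)\<^sup>*\<^sup>* (hd (splice ss es)) (last (splice ss es))"
      by (intro successively_imp_rtranclp) (auto simp: simple_path_def)
    then show ?thesis using hd_last_splice[OF len] p by simp
  qed simp
  moreover have "incident K n x s" "incident K n t y" using s t xy by (auto simp: incident_def)
  ultimately show "(incident K n)\<^sup>*\<^sup>* x y"
    by (meson converse_rtranclp_into_rtranclp rtranclp.rtrancl_into_rtrancl)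
qed

section \<open>Reduced paths between ridges\<close>

text \<open>If an end ridge lay in a further facet of the path, the edge between them and the
  corresponding stretch of the path would be two simple paths with the same ends. Uniqueness makes
  them equal, so the stretch has length 2.\<close>

lemma acyclic_path_seq_reduced:
  assumes n: "0 < n" and ac: "acyclic_complex K n" and ps: "path_seq K (n - 1) n ss es"
  shows "reduced_path_seq K (n - 1) n ss es"
proof -
  have w: "walk_seq K (n - 1) n ss es" and d: "distinct ss" using ps by (auto simp: path_seq_def)
  have ww: "length ss = Suc (length es)" "set ss \<subseteq> simplices K (n - 1)" "set es \<subseteq> simplices K n"
    using w by (auto simp: walk_seq_def)
  have ne: "ss \<noteq> []" using ww by auto
  let ?p = "splice ss es"
  have p: "simple_path (incident K n) ?p" by (rule path_seq_imp_simple_path[OF n ps])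
  have edge: "simple_path (incident K n) [x, e]" "simple_path (incident K n) [e, x]"
    if "x \<in> set ss" "e \<in> set es" "x \<subseteq> e" for x e
    using that ww simplices_disjoint[of "n - 1" n K] n
    by (auto simp: simple_path_def incident_def)
  have "k = 0" if k: "k < length es" "hd ss \<subseteq> es ! k" for k
  proof -
    obtain q where q: "simple_path (incident K n) q" "hd q = ?p ! 0" "last q = ?p ! Suc (2 * k)"
      "length q = Suc (Suc (2 * k)) - 0"
      by (rule simple_path_slice[OF p, of 0 "Suc (2 * k)"]) (use k ww in auto)
    have "[hd ss, es ! k] = q"
      using edge(1)[of "hd ss" "es ! k"] q k ww ne nth_splice_odd[OF ww(1) k(1)]
        nth_splice_even[OF ww(1), of 0]
      by (intro incident_path_unique[OF n ac]) (auto simp: hd_conv_nth)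
    then show ?thesis using q(4) by auto
  qed
  moreover have "k = length es - 1" if k: "k < length es" "last ss \<subseteq> es ! k" for k
  proof -
    obtain q where q: "simple_path (incident K n) q" "hd q = ?p ! Suc (2 * k)"
      "last q = ?p ! (2 * length es)" "length q = Suc (2 * length es) - Suc (2 * k)"
      by (rule simple_path_slice[OF p, of "Suc (2 * k)" "2 * length es"]) (use k ww in auto)
    have "[es ! k, last ss] = q"
      using edge(2)[of "last ss" "es ! k"] q k ww ne nth_splice_odd[OF ww(1) k(1)]
        nth_splice_even[OF ww(1), of "length es"]
      by (intro incident_path_unique[OF n ac]) (auto simp: last_conv_nth)
    then have "length q = 2" by auto
    then show ?thesis using q(4) k by auto
  qed
  moreover have "linked K n ss es"
    using linked_ridges[OF w] d by (simp add: distinct_tl distinct_butlast)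
  ultimately show ?thesis using ps by (simp add: reduced_path_seq_def)
qed

lemma acyclic_ridge_path_unique:
  assumes n: "0 < n" and ac: "acyclic_complex K n" and con: "connected_complex K n"
    and x: "x \<in> simplices K (n - 1)" and y: "y \<in> simplices K (n - 1)" and "x \<noteq> y"
  shows "\<exists>!p. reduced_path_between K (n - 1) n x y p"
proof -
  obtain ss es where p: "path_seq K (n - 1) n ss es" "hd ss = x" "last ss = y"
    using con x y \<open>x \<noteq> y\<close> unfolding connected_complex_def by blast
  show ?thesis
  proof (rule ex1I[of _ "(ss, es)"])
    show "reduced_path_between K (n - 1) n x y (ss, es)"
      using acyclic_path_seq_reduced[OF n ac p(1)] p by (simp add: reduced_path_between_def)
    fix q assume "reduced_path_between K (n - 1) n x y q"
    then obtain ss' es' where q: "q = (ss', es')" "path_seq K (n - 1) n ss' es'" "hd ss' = x" "last ss' = y"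
      by (cases q) (auto simp: reduced_path_between_def reduced_path_seq_def)
    have len: "length ss = Suc (length es)" "length ss' = Suc (length es')"
      using p q by (auto simp: path_seq_def walk_seq_def)
    have "splice ss es = splice ss' es'"
      using path_seq_imp_simple_path[OF n p(1)] path_seq_imp_simple_path[OF n q(2)]
        hd_last_splice[OF len(1)] hd_last_splice[OF len(2)] p q
      by (intro incident_path_unique[OF n ac]) auto
    from splice_eq_imp_eq[OF len this] show "q = (ss, es)" using q(1) by simp
  qed
qed

text \<open>From the second ridge of the cycle to the first one there is the short way through the
  first facet and the long way round. The long way may violate condition (i) at its start, so it has
  to be shortened.\<close>

lemma ridge_cycle_imp_two_reduced_paths:
  assumes n: "0 < n" and cyc: "simplicial_cycle_seq K (n - 1) n ss es"
  shows "\<exists>x\<in>simplices K (n - 1). \<exists>y\<in>simplices K (n - 1). x \<noteq> y \<and>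
    \<not> (\<exists>!p. reduced_path_between K (n - 1) n x y p)"
proof -
  have w: "walk_seq K (n - 1) n ss es" and lh: "last ss = hd ss" and ds: "distinct (butlast ss)"
    and de: "distinct es" and l3: "3 \<le> length es"
    and nh: "\<forall>k\<in>{1..<length es - 1}. \<not> hd ss \<subseteq> es ! k"
    using cyc by (auto simp: simplicial_cycle_seq_def circuit_seq_def)
  have ww: "length ss = Suc (length es)" "set ss \<subseteq> simplices K (n - 1)" "set es \<subseteq> simplices K n"
    "\<forall>k<length es. ss ! k \<noteq> ss ! Suc k \<and> ss ! k \<subseteq> es ! k \<and> ss ! Suc k \<subseteq> es ! k"
    using w by (auto simp: walk_seq_def)
  have ne: "ss \<noteq> []" using ww by auto
  have h0: "hd ss = ss ! 0" using ne by (rule hd_conv_nth)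
  have last0: "ss ! length es = ss ! 0" using lh h0 ww(1) ne by (simp add: last_conv_nth)
  have ssd: "ss ! i \<noteq> ss ! j" if "i < length es" "j < length es" "i \<noteq> j" for i j
    using ds that ww(1) by (auto simp: distinct_conv_nth nth_butlast)
  have ssm: "ss ! i \<in> simplices K (n - 1)" if "i \<le> length es" for i
    using ww(1,2) that by (auto simp: subset_iff)
  have esm: "es ! i \<in> simplices K n" if "i < length es" for i
    using ww(3) that by (auto simp: subset_iff)
  let ?x = "ss ! 1" and ?y = "ss ! 0"
  have xy: "?x \<noteq> ?y" using l3 by (intro ssd) auto
  have esne: "es \<noteq> []" using l3 by auto
  have disj: "set as \<inter> set bs = {}" if "set as \<subseteq> simplices K (n - 1)" "set bs \<subseteq> simplices K n"
    for as bs using that simplices_disjoint[of "n - 1" n K] n by auto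
  have s1: "reduced_path_seq K (n - 1) n [?x, ?y] [es ! 0]"
  proof -
    have w1: "walk_seq K (n - 1) n [?x, ?y] [es ! 0]"
      using ww(4)[rule_format, of 0] ssm[of 0] ssm[of 1] esm[of 0] xy l3 esne
      by (auto simp: walk_seq_def)
    moreover have "distinct ([?x, ?y] @ [es ! 0])"
      using disj[of "[?x, ?y]" "[es ! 0]"] ssm[of 0] ssm[of 1] esm[of 0] xy l3 esne by auto
    moreover have "linked K n [?x, ?y] [es ! 0]" by (rule linked_ridges[OF w1]) simp
    ultimately show ?thesis by (simp add: reduced_path_seq_def path_seq_def)
  qed
  \<comment> \<open>The long way enters directly at the last facet containing \<open>?x\<close>,
    skipping everything before it; this secures condition (i) at the start.\<close>
  define k where "k = Max {j. j < length es \<and> ?x \<subseteq> es ! j}"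
  let ?J = "{j. j < length es \<and> ?x \<subseteq> es ! j}"
  have J1: "1 \<in> ?J" using ww(4)[rule_format, of 1] l3 by auto
  have fin: "finite ?J" by simp
  have kJ: "k \<in> ?J" unfolding k_def using Max_in[OF fin] J1 by blast
  have kmax: "j \<le> k" if "j < length es" "?x \<subseteq> es ! j" for j
    unfolding k_def using Max_ge[OF fin, of j] that by simp
  have k1: "1 \<le> k" using kmax J1 by blast
  have kl: "k < length es" using kJ by simp
  let ?ss = "?x # drop (Suc k) ss" and ?es = "drop k es"
  have len: "length ?ss = Suc (length ?es)" using ww(1) kl by simp
  have ssS: "?ss ! Suc i = ss ! (Suc (k + i))" if "i < length ?es" for i
    using that ww(1) by simp
  have ssI: "?ss ! i \<subseteq> ?es ! i \<and> ?ss ! i \<noteq> ?ss ! Suc i" if i: "i < length ?es" for i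
  proof (cases i)
    case 0
    have "ss ! 1 \<noteq> ss ! Suc k"
      using ssd[of 1 "Suc k"] xy last0 k1 kl l3 by (cases "Suc k = length es") auto
    then show ?thesis using 0 kJ kl ssS[OF i] by simp
  next
    case (Suc j)
    then have "?ss ! i = ss ! (k + i)" using ssS[of j] i by simp
    then show ?thesis using ssS[OF i] ww(4)[rule_format, of "k + i"] i by simp
  qed
  have w2: "walk_seq K (n - 1) n ?ss ?es"
    unfolding walk_seq_def
  proof (intro conjI allI impI)
    show "?es \<noteq> []" using kl by simp
    show "length ?ss = length ?es + 1" using len by simp
    show "set ?ss \<subseteq> simplices K (n - 1)" "set ?es \<subseteq> simplices K n"
      using ww(2,3) ssm[of 1] l3 by (auto dest: in_set_dropD)
    fix i assume i: "i < length ?es"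
    show "?ss ! i \<subseteq> ?es ! i" "?ss ! i \<noteq> ?ss ! (i + 1)" using ssI[OF i] by auto
    show "?ss ! (i + 1) \<subseteq> ?es ! i"
      using ssS[OF i] ww(4)[rule_format, of "k + i"] i by simp
  qed
  have dss: "distinct ?ss"
  proof -
    have "ss ! i \<noteq> ss ! j" if "1 \<le> i" "i < j" "j \<le> length es" for i j
      using that ssd[of i j] ssd[of i 0] last0 esne by (cases "j = length es") auto
    note inj = this
    have "ss ! 1 \<notin> set (drop (Suc k) ss)"
    proof
      assume "ss ! 1 \<in> set (drop (Suc k) ss)"
      then obtain i where "i < length es - k" "ss ! 1 = ss ! (Suc k + i)"
        using ww(1) by (auto simp: in_set_conv_nth)
      moreover from this have "ss ! 1 \<noteq> ss ! (Suc k + i)" using k1 kl by (intro inj) auto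
      ultimately show False by blast
    qed
    moreover have "distinct (drop (Suc k) ss)"
    proof (unfold distinct_conv_nth, intro allI impI)
      fix i j assume ij: "i < length (drop (Suc k) ss)" "j < length (drop (Suc k) ss)" "i \<noteq> j"
      then show "drop (Suc k) ss ! i \<noteq> drop (Suc k) ss ! j"
        using inj[of "Suc k + i" "Suc k + j"] inj[of "Suc k + j" "Suc k + i"] ww(1) kl
        by (cases "i < j") force+
    qed
    ultimately show ?thesis by simp
  qed
  have l2: "last ?ss = ?y" using lh h0 kl ww(1) by simp
  have s2: "reduced_path_seq K (n - 1) n ?ss ?es"
    unfolding reduced_path_seq_def
  proof (intro conjI allI impI)
    have "set ?ss \<inter> set ?es = {}" using w2 by (intro disj) (auto simp: walk_seq_def)
    then have "distinct (?ss @ ?es)" using dss de by (simp only: distinct_append) simp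
    with w2 show "path_seq K (n - 1) n ?ss ?es" by (simp only: path_seq_def)
    show "linked K n ?ss ?es"
      by (rule linked_ridges[OF w2]) (intro distinct_tl distinct_butlast dss)
    fix i assume i: "i < length ?es"
    show "i = 0" if "hd ?ss \<subseteq> ?es ! i" using kmax[of "k + i"] that i by simp
    show "i = length ?es - 1" if "last ?ss \<subseteq> ?es ! i"
    proof (rule ccontr)
      assume "i \<noteq> length ?es - 1"
      \<comment> \<open>\<open>1 \<le> k\<close> keeps the index away from \<open>es ! 0\<close>,
        which does contain \<open>hd ss\<close>. For the facets strictly between first and last, the
        definition of a cycle sequence gives condition (i) at the end.\<close>
      then have "k + i \<in> {1..<length es - 1}" using i k1 by auto
      then have "\<not> hd ss \<subseteq> es ! (k + i)" using nh by blast
      then show False using that l2 h0 i by simp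
    qed
  qed
  have "[es ! 0] \<noteq> ?es"
  proof
    assume "[es ! 0] = ?es"
    then have "es ! 0 = es ! k" using kl by (metis hd_drop_conv_nth list.sel(1))
    then show False using nth_eq_iff_index_eq[OF de, of 0 k] k1 kl esne by simp
  qed
  moreover have "reduced_path_between K (n - 1) n ?x ?y ([?x, ?y], [es ! 0])"
    using s1 by (simp add: reduced_path_between_def)
  moreover have "reduced_path_between K (n - 1) n ?x ?y (?ss, ?es)"
    using s2 l2 by (simp add: reduced_path_between_def)
  ultimately have "\<not> (\<exists>!p. reduced_path_between K (n - 1) n ?x ?y p)" by (metis prod.inject)
  moreover have "?x \<in> simplices K (n - 1)" "?y \<in> simplices K (n - 1)" using ssm[of 0] ssm[of 1] l3 by auto
  ultimately show ?thesis by (intro bexI[of _ ?x] bexI[of _ ?y] conjI xy)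
qed

section \<open>Reduced paths between lower-dimensional simplices\<close>

text \<open>A shortest path from a facet containing \<open>x\<close> to a facet containing
  \<open>y\<close> works: a further facet containing \<open>x\<close> or \<open>y\<close> would
  allow cutting it, which gives (i), and convexity provides distinct \<open>m\<close>-faces of its
  ridges, which gives (ii).\<close>

lemma acyclic_reduced_path_exists:
  assumes n: "0 < n" and pure: "pure_complex V K n" and ac: "acyclic_complex K n"
    and con: "connected_complex K n" and m: "m < n"
    and x: "x \<in> simplices K m" and y: "y \<in> simplices K m" and "x \<noteq> y"
  shows "\<exists>p. reduced_path_between K m n x y p"
proof -
  have K: "simplicial_complex V K" using pure by (simp add: pure_complex_def)
  let ?R = "\<lambda>p. simple_path (incident K n) p \<and> hd p \<in> simplices K n \<and> last p \<in> simplices K n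
    \<and> x \<subseteq> hd p \<and> y \<subseteq> last p"
  have "\<forall>s\<in>K. \<exists>e\<in>simplices K n. s \<subseteq> e" using pure by (simp add: pure_complex_def)
  then obtain e f where ef: "e \<in> simplices K n" "x \<subseteq> e" "f \<in> simplices K n" "y \<subseteq> f"
    using x y by (auto simp: simplices_def) metis
  have "\<exists>p. ?R p" using incident_path_exists[OF n K con ef(1,3)] ef by auto
  then obtain p where R: "?R p" and least: "\<And>q. ?R q \<Longrightarrow> length p \<le> length q"
    using ex_has_least_nat[of ?R _ length] by blast
  have p: "simple_path (incident K n) p" using R by blast
  obtain es ts where pp: "p = splice es ts" and g: "gallery K n ts es"
    using simple_path_imp_gallery[OF n p] R by blast
  have gg: "length es = Suc (length ts)" "set es \<subseteq> simplices K n" "set ts \<subseteq> simplices K (n - 1)"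
    "distinct ts" "distinct es" "\<forall>i<length ts. ts ! i \<subseteq> es ! i \<and> ts ! i \<subseteq> es ! Suc i"
    using g by (auto simp: gallery_def)
  have lp: "length p = Suc (2 * length ts)" using gg(1) by (simp add: pp)
  have pne: "p \<noteq> []" using lp by auto
  have esne: "es \<noteq> []" using gg(1) by auto
  have esn: "p ! (2 * i) = es ! i" if "i < length es" for i
    using that gg(1) by (simp add: pp nth_splice_even)
  have tsn: "p ! Suc (2 * i) = ts ! i" if "i < length ts" for i
    using that gg(1) by (simp add: pp nth_splice_odd)
  have esm: "es ! i \<in> simplices K n" if "i < length es" for i
    using gg(2) that by (auto simp: subset_iff)
  have tsm: "ts ! i \<in> simplices K (n - 1)" if "i < length ts" for i
    using gg(3) that by (auto simp: subset_iff)
  have ends: "x \<subseteq> hd es" "y \<subseteq> last es" using R hd_last_splice[OF gg(1)] by (auto simp: pp)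
  have xonly: "k = 0" if k: "k < length es" "x \<subseteq> es ! k" for k
  proof -
    obtain q where q: "simple_path (incident K n) q" "hd q = p ! (2 * k)"
      "last q = p ! (2 * length ts)" "length q = Suc (2 * length ts) - 2 * k"
      by (rule simple_path_slice[OF p, of "2 * k" "2 * length ts"]) (use k gg lp in auto)
    have "last q = last p" using q(3) pne lp by (simp add: last_conv_nth)
    then have "?R q" using q R k esn[OF k(1)] esm[OF k(1)] by auto
    from least[OF this] show ?thesis using q(4) lp by simp
  qed
  have yonly: "k = length es - 1" if k: "k < length es" "y \<subseteq> es ! k" for k
  proof -
    obtain q where q: "simple_path (incident K n) q" "hd q = p ! 0"
      "last q = p ! (2 * k)" "length q = Suc (2 * k) - 0"
      by (rule simple_path_slice[OF p, of 0 "2 * k"]) (use k gg lp in auto)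
    have "hd q = hd p" using q(2) pne by (simp add: hd_conv_nth)
    then have "?R q" using q R k esn[OF k(1)] esm[OF k(1)] by auto
    from least[OF this] show ?thesis using q(4) lp k gg(1) by simp
  qed
  have "\<exists>us. length us = length ts \<and> distinct us \<and>
    (\<forall>i<length ts. us ! i \<subseteq> ts ! i \<and> card (us ! i) = Suc m)"
  proof (rule distinct_subset_representatives[OF _ m gg(4)])
    show "card t = n" if "t \<in> set ts" for t
      using that gg(3) n card_simplices[of t K "n - 1"] by auto
    fix i j l assume ijl: "i < j" "j < l" "l < length ts"
    show "ts ! i \<inter> ts ! l \<subseteq> ts ! j"
      using incident_path_convex_nth[OF n K ac p, of "Suc (2 * i)" "Suc (2 * j)" "Suc (2 * l)"]
        ijl lp by (simp add: tsn)
  qed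
  then obtain us where us: "length us = length ts" "distinct us"
    "\<forall>i<length ts. us ! i \<subseteq> ts ! i \<and> card (us ! i) = Suc m" by blast
  have usK: "us ! i \<in> simplices K m \<and> us ! i \<subseteq> ts ! i" if "i < length ts" for i
    using face_in_simplices[OF K, of "ts ! i" "us ! i" m] us(3) tsm[OF that] that
    by (auto simp: simplices_def)
  \<comment> \<open>A chosen face equal to \<open>x\<close> would put \<open>x\<close> into the
    facet after its ridge, against \<open>xonly\<close>. For \<open>y\<close> it is the facet
    before.\<close>
  have xus: "x \<notin> set us"
  proof
    assume "x \<in> set us"
    then obtain i where i: "i < length ts" "us ! i = x" using us(1) by (auto simp: in_set_conv_nth)
    then have "x \<subseteq> es ! Suc i" using usK[of i] gg(6) by blast
    then show False using xonly[of "Suc i"] i gg(1) by simp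
  qed
  have yus: "y \<notin> set us"
  proof
    assume "y \<in> set us"
    then obtain i where i: "i < length ts" "us ! i = y" using us(1) by (auto simp: in_set_conv_nth)
    then have "y \<subseteq> es ! i" using usK[of i] gg(6) by blast
    then show False using yonly[of i] i gg(1) by simp
  qed
  have "ts \<noteq> [] \<or> x \<noteq> y" using \<open>x \<noteq> y\<close> by blast
  note w = gallery_walk_seq[OF g us(1) usK us(2) x ends(1) y ends(2) xus yus this]
  have "set (x # us @ [y]) \<inter> set es = {}"
    using w(1) simplices_disjoint[OF m, of K] unfolding walk_seq_def by blast
  then have "distinct ((x # us @ [y]) @ es)"
    using us(2) xus yus \<open>x \<noteq> y\<close> gg(5) by auto
  then have "path_seq K m n (x # us @ [y]) es" using w(1) by (simp only: path_seq_def)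
  then have "reduced_path_seq K m n (x # us @ [y]) es"
    using w(2) xonly yonly unfolding reduced_path_seq_def by simp
  then show ?thesis
    by (intro exI[of _ "(x # us @ [y], es)"]) (simp add: reduced_path_between_def)
qed

text \<open>The way back to the incidence graph: the inner \<open>m\<close>-simplices are forgotten
  and the linking ridges take their place. The end conditions extend from facets to ridges because
  each linking ridge lies in two consecutive facets, of which one is not the first and one is not
  the last.\<close>

lemma reduced_path_seq_gallery:
  assumes "reduced_path_seq K m n ss es"
  obtains ts where "gallery K n ts es" "hd ss \<subseteq> hd es" "last ss \<subseteq> last es"
    "\<forall>e\<in>set (splice es ts). hd ss \<subseteq> e \<longrightarrow> e = hd es"
    "\<forall>e\<in>set (splice es ts). last ss \<subseteq> e \<longrightarrow> e = last es"
proof -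
  have ww: "es \<noteq> []" "length ss = Suc (length es)" "set es \<subseteq> simplices K n" "distinct es"
    "\<forall>k<length es. ss ! k \<subseteq> es ! k \<and> ss ! Suc k \<subseteq> es ! k"
    and ho: "\<forall>k<length es. hd ss \<subseteq> es ! k \<longrightarrow> k = 0"
    and lo: "\<forall>k<length es. last ss \<subseteq> es ! k \<longrightarrow> k = length es - 1"
    using assms by (auto simp: reduced_path_seq_def path_seq_def walk_seq_def)
  obtain f where f: "\<forall>z\<in>{1..<length es}. f z \<in> simplices K (n - 1) \<and>
      f z \<subseteq> es ! (z - 1) \<and> f z \<subseteq> es ! z \<and> ss ! z \<subseteq> f z" and inj: "inj_on f {1..<length es}"
    using assms unfolding reduced_path_seq_def linked_def by blast
  let ?ts = "map f [1..<length es]"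
  have lt: "length es = Suc (length ?ts)" using ww(1) by simp
  have fi: "f (Suc i) \<subseteq> es ! i \<and> f (Suc i) \<subseteq> es ! Suc i" if "Suc i < length es" for i
    using f[rule_format, of "Suc i"] that by simp
  have g: "gallery K n ?ts es"
    unfolding gallery_def
  proof (intro conjI)
    show "length es = Suc (length ?ts)" by (rule lt)
    show "set es \<subseteq> simplices K n" "distinct es" by fact+
    show "set ?ts \<subseteq> simplices K (n - 1)" using f by auto
    show "distinct ?ts" using inj by (simp add: distinct_map)
    show "\<forall>i<length ?ts. ?ts ! i \<subseteq> es ! i \<and> ?ts ! i \<subseteq> es ! Suc i" using fi by auto
  qed
  have ne: "ss \<noteq> []" using ww(2) by auto
  have h: "hd ss \<subseteq> hd es" using ww(5)[rule_format, of 0] ww(1) ne by (simp add: hd_conv_nth)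
  have l: "last ss \<subseteq> last es"
    using ww(5)[rule_format, of "length es - 1"] ww(1,2) ne by (simp add: last_conv_nth)
  have mem: "(\<exists>k<length es. e = es ! k) \<or> (\<exists>k. Suc k < length es \<and> e \<subseteq> es ! k \<and> e \<subseteq> es ! Suc k)"
    if "e \<in> set (splice es ?ts)" for e
  proof -
    have "e \<in> set es \<or> e \<in> set ?ts"
      using that set_shuffles[OF splice_in_shuffles, of es ?ts] by auto
    then show ?thesis
    proof
      assume "e \<in> set ?ts"
      then obtain k where "k < length ?ts" "?ts ! k = e" by (metis in_set_conv_nth)
      then show ?thesis using fi[of k] by (intro disjI2 exI[of _ k]) auto
    qed (auto simp: in_set_conv_nth)
  qed
  have h': "e = hd es" if e: "e \<in> set (splice es ?ts)" "hd ss \<subseteq> e" for e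
    using mem[OF e(1)]
  proof (elim disjE exE conjE)
    fix k assume "k < length es" "e = es ! k"
    then show ?thesis using ho e(2) ww(1) by (auto simp: hd_conv_nth)
  next
    fix k assume k: "Suc k < length es" "e \<subseteq> es ! Suc k"
    then show ?thesis using ho[rule_format, of "Suc k"] e(2) by auto
  qed
  have l': "e = last es" if e: "e \<in> set (splice es ?ts)" "last ss \<subseteq> e" for e
    using mem[OF e(1)]
  proof (elim disjE exE conjE)
    fix k assume "k < length es" "e = es ! k"
    then show ?thesis using lo e(2) ww(1) by (auto simp: last_conv_nth)
  next
    fix k assume k: "Suc k < length es" "e \<subseteq> es ! k"
    then have "k = length es - 1" using lo[rule_format, of k] e(2) by auto
    then show ?thesis using k(1) by simp
  qed
  show ?thesis by (rule that[OF g h l]) (use h' l' in blast)+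
qed

text \<open>What remains of a reduced path sequence in the incidence graph once its inner
  \<open>m\<close>-simplices are forgotten, with both end conditions extended to the ridges. In this
  form two reduced paths can be compared by uniqueness of simple paths.\<close>

definition star_path :: "'v set set \<Rightarrow> nat \<Rightarrow> 'v set \<Rightarrow> 'v set \<Rightarrow> 'v set list \<Rightarrow> bool" where
  "star_path K n x y p \<longleftrightarrow> simple_path (incident K n) p \<and>
     hd p \<in> simplices K n \<and> last p \<in> simplices K n \<and> x \<subseteq> hd p \<and> y \<subseteq> last p \<and>
     (\<forall>e\<in>set p. x \<subseteq> e \<longrightarrow> e = hd p) \<and> (\<forall>e\<in>set p. y \<subseteq> e \<longrightarrow> e = last p)"

text \<open>
  With \<open>a\<close> the path from \<open>hd p\<close> to \<open>hd q\<close> inside the star of \<open>x\<close> and \<open>b\<close> the path from \<open>last p\<close>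
  to \<open>last q\<close> inside the star of \<open>y\<close>, uniqueness of paths gives \<open>p @ tl b = a @ tl q\<close>.
\<close>

lemma star_path_unique_long:
  assumes n: "0 < n" and K: "simplicial_complex V K" and ac: "acyclic_complex K n"
    and con: "connected_complex K n" and P: "star_path K n x y p" and Q: "star_path K n x y q"
    and l2: "2 \<le> length p"
  shows "p = q"
proof -
  have p: "simple_path (incident K n) p" "hd p \<in> simplices K n" "last p \<in> simplices K n"
    "x \<subseteq> hd p" "y \<subseteq> last p" "\<And>e. e \<in> set p \<Longrightarrow> x \<subseteq> e \<Longrightarrow> e = hd p"
    "\<And>e. e \<in> set p \<Longrightarrow> y \<subseteq> e \<Longrightarrow> e = last p"
    using P unfolding star_path_def by blast+
  have q: "simple_path (incident K n) q" "hd q \<in> simplices K n" "last q \<in> simplices K n"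
    "x \<subseteq> hd q" "y \<subseteq> last q" "\<And>e. e \<in> set q \<Longrightarrow> x \<subseteq> e \<Longrightarrow> e = hd q"
    "\<And>e. e \<in> set q \<Longrightarrow> y \<subseteq> e \<Longrightarrow> e = last q"
    using Q unfolding star_path_def by blast+
  obtain a where a: "simple_path (incident K n) a" "hd a = hd p" "last a = hd q"
    using incident_path_exists[OF n K con p(2) q(2)] by blast
  obtain b where b: "simple_path (incident K n) b" "hd b = last p" "last b = last q"
    using incident_path_exists[OF n K con p(3) q(3)] by blast
  have ax: "x \<subseteq> e" if "e \<in> set a" for e
    using incident_path_convex_subset[OF n K ac a(1), of x e] a p(4) q(4) that by simp
  have yb: "y \<subseteq> e" if "e \<in> set b" for e
    using incident_path_convex_subset[OF n K ac b(1), of y e] b p(5) q(5) that by simp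
  have ne: "p \<noteq> []" "q \<noteq> []" "a \<noteq> []" "b \<noteq> []" using p q a b by (auto simp: simple_path_def)
  \<comment> \<open>All of \<open>b\<close> contains \<open>y\<close>, and \<open>p\<close> has only
    its last entry in the star of \<open>y\<close>, so the two meet only where they are joined. The
    same holds for \<open>a\<close> and \<open>q\<close> with \<open>x\<close>.\<close>
  have pb: "simple_path (incident K n) (p @ tl b)"
    by (rule simple_path_append_tl[OF p(1) b(1)]) (use b(2) p(7) yb in auto)
  have aq: "simple_path (incident K n) (a @ tl q)"
    by (rule simple_path_append_tl[OF a(1) q(1)]) (use a(3) q(6) ax in auto)
  have "last (p @ tl b) = last q" using last_append_tl[OF ne(4), of p] b by simp
  moreover have "last (a @ tl q) = last q" using last_append_tl[OF ne(2), of a] a by simp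
  moreover have "hd (p @ tl b) = hd (a @ tl q)" using a(2) ne by simp
  ultimately have eq: "p @ tl b = a @ tl q"
    by (intro incident_path_unique[OF n ac pb aq]) auto
  obtain p0 p1 p' where p': "p = p0 # p1 # p'"
    using l2 by (auto simp: numeral_2_eq_2 Suc_le_length_iff)
  obtain a0 a' where a': "a = a0 # a'" using ne by (cases a) auto
  \<comment> \<open>By \<open>eq\<close> a second entry of \<open>a\<close> would be the second
    entry \<open>p1\<close> of \<open>p\<close>. It would contain \<open>x\<close> without being
    \<open>hd p\<close>; this is where \<open>2 \<le> length p\<close> enters.\<close>
  have "a' = []"
  proof (rule ccontr)
    assume "a' \<noteq> []"
    then obtain a1 a'' where "a' = a1 # a''" by (cases a') auto
    then have "p1 \<in> set a" using eq p' a' by simp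
    then have "p1 = p0" using p(6)[of p1] ax[of p1] p' by simp
    then show False using p(1) p' by (simp add: simple_path_def)
  qed
  then have "a @ tl q = q" using a' a(3) ne(2) by simp
  then have pq: "p @ tl b = q" using eq by simp
  \<comment> \<open>Now \<open>p\<close> is a prefix of \<open>q\<close>. As \<open>q\<close> meets
    the star of \<open>y\<close> only at its end, both paths end in the same facet, and
    \<open>b\<close> is trivial too.\<close>
  have "last p \<in> set q" using ne(1) unfolding pq[symmetric] by simp
  then have lpq: "last p = last q" using q(7) p(5) by blast
  have "tl b = []"
  proof (rule ccontr)
    assume "tl b \<noteq> []"
    moreover have "b = hd b # tl b" using ne by simp
    ultimately have "last b \<in> set (tl b)" "hd b \<notin> set (tl b)"
      using b(1) by (metis last_ConsR last_in_set, metis distinct.simps(2) simple_path_def)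
    then show False using b lpq by simp
  qed
  then show ?thesis using pq by simp
qed

text \<open>What is left is the case of two single facets, each containing both \<open>x\<close> and
  \<open>y\<close>. By convexity the path joining them stays in both stars, so its first ridge, if
  there is one, is a joint ridge containing \<open>x\<close> and \<open>y\<close>.\<close>

lemma star_path_unique:
  assumes n: "0 < n" and K: "simplicial_complex V K" and ac: "acyclic_complex K n"
    and con: "connected_complex K n" and P: "star_path K n x y p" and Q: "star_path K n x y q"
    and nj: "\<not> (\<exists>\<rho>\<in>simplices K (n - 1). joint K n \<rho> \<and> x \<subseteq> \<rho> \<and> y \<subseteq> \<rho>)"
  shows "p = q"
proof (cases "2 \<le> length p \<or> 2 \<le> length q")
  case True
  then show ?thesis
    using star_path_unique_long[OF n K ac con P Q] star_path_unique_long[OF n K ac con Q P] by blast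
next
  case False
  moreover have "p \<noteq> []" "q \<noteq> []" using P Q by (auto simp: star_path_def simple_path_def)
  ultimately obtain e f where ef: "p = [e]" "q = [f]"
    by (cases p; cases q; cases "tl p"; cases "tl q") auto
  have K': "e \<in> simplices K n" "f \<in> simplices K n" "x \<subseteq> e" "y \<subseteq> e" "x \<subseteq> f" "y \<subseteq> f"
    using P Q by (auto simp: star_path_def ef)
  obtain b where b: "simple_path (incident K n) b" "hd b = e" "last b = f"
    using incident_path_exists[OF n K con K'(1,2)] by blast
  obtain es ts where bb: "b = splice es ts" and g: "gallery K n ts es"
    using simple_path_imp_gallery[OF n b(1)] b K' by blast
  have gg: "length es = Suc (length ts)" "set es \<subseteq> simplices K n" "set ts \<subseteq> simplices K (n - 1)"
    "distinct es" "\<forall>i<length ts. ts ! i \<subseteq> es ! i \<and> ts ! i \<subseteq> es ! Suc i"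
    using g by (auto simp: gallery_def)
  have "ts = []"
  proof (rule ccontr)
    assume "ts \<noteq> []"
    then have pos: "0 < length ts" by simp
    have t: "ts ! 0 \<in> set b"
      using set_shuffles[OF splice_in_shuffles, of es ts] pos by (simp add: bb)
    have "x \<subseteq> ts ! 0" "y \<subseteq> ts ! 0"
      using incident_path_convex_subset[OF n K ac b(1) _ _ t] b K' by auto
    moreover have "ts ! 0 \<in> simplices K (n - 1)" using gg(3) pos by (auto simp: subset_iff)
    moreover have "joint K n (ts ! 0)"
    proof -
      have "es ! 0 \<in> simplices K n" "es ! 1 \<in> simplices K n" "es ! 0 \<noteq> es ! 1"
        using gg(1,2,4) pos by (auto simp: subset_iff nth_eq_iff_index_eq)
      then show ?thesis using gg(5) pos unfolding joint_def by (metis One_nat_def)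
    qed
    ultimately show False using nj by blast
  qed
  then have "e = f" using b gg(1) by (cases es) (auto simp: bb)
  then show ?thesis using ef by simp
qed

lemma acyclic_reduced_simplicial_path_unique:
  assumes n: "0 < n" and pure: "pure_complex V K n" and ac: "acyclic_complex K n"
    and con: "connected_complex K n" and m: "m < n"
    and x: "x \<in> simplices K m" and y: "y \<in> simplices K m" and "x \<noteq> y"
    and nj: "\<not> (\<exists>\<rho>\<in>simplices K (n - 1). joint K n \<rho> \<and> x \<subseteq> \<rho> \<and> y \<subseteq> \<rho>)"
  shows "\<exists>!P. reduced_simplicial_path K m n x y P"
proof -
  have K: "simplicial_complex V K" using pure by (simp add: pure_complex_def)
  have star: "\<exists>ts. length (snd r) = Suc (length ts) \<and> star_path K n x y (splice (snd r) ts)"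
    if "reduced_path_between K m n x y r" for r
  proof -
    have r: "reduced_path_seq K m n (fst r) (snd r)" "hd (fst r) = x" "last (fst r) = y"
      using that by (auto simp: reduced_path_between_def)
    obtain ts where ts: "gallery K n ts (snd r)" "x \<subseteq> hd (snd r)" "y \<subseteq> last (snd r)"
      "\<forall>e\<in>set (splice (snd r) ts). x \<subseteq> e \<longrightarrow> e = hd (snd r)"
      "\<forall>e\<in>set (splice (snd r) ts). y \<subseteq> e \<longrightarrow> e = last (snd r)"
      using reduced_path_seq_gallery[OF r(1)] r(2,3) by metis
    have len: "length (snd r) = Suc (length ts)" and sub: "set (snd r) \<subseteq> simplices K n"
      using ts(1) by (auto simp: gallery_def)
    have ne: "snd r \<noteq> []" using len by auto
    have "hd (snd r) \<in> simplices K n" "last (snd r) \<in> simplices K n"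
      using sub ne hd_in_set last_in_set by blast+
    then show ?thesis
      using gallery_imp_simple_path[OF n ts(1)] ts len hd_last_splice[OF len]
      by (intro exI[of _ ts]) (simp add: star_path_def)
  qed
  \<comment> \<open>The facets can be read off from the star path as the entries at even positions,
    and \<open>face_closure\<close> depends on nothing else.\<close>
  have "snd r = snd r'"
    if "reduced_path_between K m n x y r" "reduced_path_between K m n x y r'" for r r'
    using star[OF that(1)] star[OF that(2)] star_path_unique[OF n K ac con _ _ nj]
      splice_eq_imp_eq by metis
  moreover obtain r where "reduced_path_between K m n x y r"
    using acyclic_reduced_path_exists[OF n pure ac con m x y \<open>x \<noteq> y\<close>] by blast
  ultimately show ?thesis unfolding reduced_simplicial_path_def by metis
qed

section \<open>The characterization of simplicial trees\<close>

theorem theorem5p1: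
  fixes V :: "'v set" and K :: "'v set set" and n :: nat
  assumes "n \<ge> 1"
    and "pure_complex V K n"
    and "connected_complex K n"
  shows "simplicial_tree V K n \<longleftrightarrow>
    (\<forall>\<sigma>\<in>simplices K (n - 1). \<forall>\<sigma>'\<in>simplices K (n - 1). \<sigma> \<noteq> \<sigma>' \<longrightarrow>
       (\<exists>!p. reduced_path_between K (n - 1) n \<sigma> \<sigma>' p)) \<and>
    (n \<ge> 2 \<longrightarrow>
       (\<forall>m\<le>n - 2. \<forall>\<sigma>\<in>simplices K m. \<forall>\<sigma>'\<in>simplices K m. \<sigma> \<noteq> \<sigma>' \<and>
          \<not> (\<exists>\<rho>\<in>simplices K (n - 1). joint K n \<rho> \<and> \<sigma> \<subseteq> \<rho> \<and> \<sigma>' \<subseteq> \<rho>) \<longrightarrow>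
          (\<exists>!P. reduced_simplicial_path K m n \<sigma> \<sigma>' P))) \<and>
    (n \<ge> 2 \<longrightarrow> (\<forall>m\<le>n - 2. \<nexists>ss es. simplicial_cycle_seq K m n ss es))"
    (is "_ \<longleftrightarrow> ?A \<and> ?B \<and> ?C")
proof
  have n: "0 < n" using assms(1) by simp
  {
    assume "simplicial_tree V K n"
    then have ac: "acyclic_complex K n" by (simp add: simplicial_tree_def)
    show "?A \<and> ?B \<and> ?C"
    proof (intro conjI impI allI ballI)
      fix \<sigma> \<sigma>' assume "\<sigma> \<in> simplices K (n - 1)" "\<sigma>' \<in> simplices K (n - 1)" "\<sigma> \<noteq> \<sigma>'"
      then show "\<exists>!p. reduced_path_between K (n - 1) n \<sigma> \<sigma>' p"
        by (rule acyclic_ridge_path_unique[OF n ac assms(3)])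
    next
      fix m \<sigma> \<sigma>'
      assume "2 \<le> n" "m \<le> n - 2" and s: "\<sigma> \<in> simplices K m" "\<sigma>' \<in> simplices K m"
        and "\<sigma> \<noteq> \<sigma>' \<and> \<not> (\<exists>\<rho>\<in>simplices K (n - 1). joint K n \<rho> \<and> \<sigma> \<subseteq> \<rho> \<and> \<sigma>' \<subseteq> \<rho>)"
      then have "m < n" "\<sigma> \<noteq> \<sigma>'"
        "\<not> (\<exists>\<rho>\<in>simplices K (n - 1). joint K n \<rho> \<and> \<sigma> \<subseteq> \<rho> \<and> \<sigma>' \<subseteq> \<rho>)" by auto
      then show "\<exists>!P. reduced_simplicial_path K m n \<sigma> \<sigma>' P"
        using acyclic_reduced_simplicial_path_unique[OF n assms(2) ac assms(3) _ s] by blast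
    next
      fix m assume "2 \<le> n" "m \<le> n - 2"
      then have "m < n" by auto
      then show "\<nexists>ss es. simplicial_cycle_seq K m n ss es"
        using ac unfolding acyclic_complex_def by blast
    qed
  next
    assume R: "?A \<and> ?B \<and> ?C"
    then have A: ?A and C: ?C by (rule conjunct1, elim conjE)
    \<comment> \<open>Every \<open>m < n\<close> is either \<open>n - 1\<close>, where a cycle would
      contradict uniqueness in (1), or at most \<open>n - 2\<close>, where \<open>2 \<le> n\<close>
      holds and (3) applies.\<close>
    have "\<not> simplicial_cycle_seq K m n ss es" if "m < n" for m ss es
    proof (cases "m = n - 1")
      case True
      show ?thesis
      proof
        assume "simplicial_cycle_seq K m n ss es"
        then have "simplicial_cycle_seq K (n - 1) n ss es" unfolding True .
        from ridge_cycle_imp_two_reduced_paths[OF n this] obtain x y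
          where "x \<in> simplices K (n - 1)" "y \<in> simplices K (n - 1)" "x \<noteq> y"
          and not_unique: "\<not> (\<exists>!p. reduced_path_between K (n - 1) n x y p)"
          by (elim bexE conjE)
        then have "\<exists>!p. reduced_path_between K (n - 1) n x y p" by (intro A[rule_format])
        with not_unique show False by (rule notE)
      qed
    next
      case False
      then have "2 \<le> n" "m \<le> n - 2" using that by auto
      then show ?thesis using C by blast
    qed
    then show "simplicial_tree V K n"
      using assms(2,3) by (auto simp: simplicial_tree_def acyclic_complex_def)
  }
qed

end
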